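(* Let $y=X\beta+\varepsilon$, where $X\in\mathbb{R}^{n\times p}$ satisfies the sub-Gaussian design assumption (see context), $\varepsilon$ has i.i.d. $N(0,\sigma^2)$ entries and is independent of $X$, and the $p=db$ coordinates are divided into $d$ groups of equal size $b_1=\dots=b_d=b$ with $d,b\ge3$. Let $s,s_g$ be positive integers with $s_g\le d$, $s_g\le s\le s_gb$, and let $\mathcal{F}_{s,s_g}=\{\beta\in\mathbb{R}^p:\|\beta\|_0\le s,\ \|\beta\|_{0,2}\le s_g\}$. Then there is a uniform constant $c>0$ such that $$\inf_{\hat\beta}\ \sup_{\beta\in\mathcal{F}_{s,s_g}}\mathbb{E}\|\hat\beta-\beta\|_2^2\ \ge\ c\,\frac{\sigma^2\left(s_g\log(ed/s_g)+s\log(es_gb/s)\right)}{n},$$ where the infimum is over all estimators $\hat\beta=\hat\beta(y,X)$.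
   Context: For $\beta\in\mathbb{R}^p$ with groups $(1),\dots,(d)$, $\beta_{(j)}$ is the subvector on group $j$, $\|\beta\|_0$ is the number of nonzero entries, and $\|\beta\|_{0,2}=\sum_{j=1}^d1_{\{\beta_{(j)}\neq0\}}$. Sub-Gaussian design assumption: the rows $X_{i\cdot}$ of $X$ are i.i.d., $\mathbb{E}X_{i\cdot}=0$, $\mathrm{Var}(X_{i\cdot}^\top)=\Sigma$, $\mathbb{E}\exp(\alpha^\top\Sigma^{-1/2}X_{i\cdot}^\top)\le\exp(\kappa^2\|\alpha\|_2^2/2)$ for all $\alpha\in\mathbb{R}^p$, with $\kappa>0$ a constant, and $c_{\min}\le\sigma_{\min}(\Sigma)\le\sigma_{\max}(\Sigma)\le C_{\max}$ for constants $C_{\max}\ge c_{\min}>0$. "Uniform constants" may depend only on $\kappa,c_{\min},C_{\max}$. *)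

theory Defs
  imports "HOL-Probability.Probability" "Jordan_Normal_Form.Spectral_Radius"
begin

text \<open>
  Since the dimensions are quantified inside the statement, vectors of length \<open>m\<close> are functions
  on \<open>nat\<close> that are extensional on \<open>{..<m}\<close>, and an \<open>n \<times> p\<close> design is a family of \<open>n\<close> rows.
  Deterministic matrices such as \<open>\<Sigma>\<close> are matrices of the Jordan normal form library.
\<close>

abbreviation vec_space :: "nat \<Rightarrow> (nat \<Rightarrow> real) measure" where
  "vec_space m \<equiv> (\<Pi>\<^sub>M j\<in>{..<m}. (borel :: real measure))"

abbreviation design_space :: "nat \<Rightarrow> nat \<Rightarrow> (nat \<Rightarrow> nat \<Rightarrow> real) measure" where
  "design_space n p \<equiv> (\<Pi>\<^sub>M i\<in>{..<n}. vec_space p)"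


definition singular_values :: "real mat \<Rightarrow> real set" where
  "singular_values A = sqrt ` spectrum (transpose_mat A * A)"

definition sigma_min :: "real mat \<Rightarrow> real" where
  "sigma_min A = Min (singular_values A)"

definition sigma_max :: "real mat \<Rightarrow> real" where
  "sigma_max A = Max (singular_values A)"

definition pos_def_mat :: "nat \<Rightarrow> real mat \<Rightarrow> bool" where
  "pos_def_mat p S \<longleftrightarrow> S \<in> carrier_mat p p \<and> transpose_mat S = S \<and>
     (\<forall>v\<in>carrier_vec p. v \<noteq> 0\<^sub>v p \<longrightarrow> 0 < scalar_prod v (S *\<^sub>v v))"

text \<open>\<open>S = A\<^sup>-\<^sup>1\<^sup>/\<^sup>2\<close>: for positive definite \<open>A\<close> there is exactly one such \<open>S\<close>.\<close>

definition is_inv_sqrt :: "nat \<Rightarrow> real mat \<Rightarrow> real mat \<Rightarrow> bool" where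
  "is_inv_sqrt p A S \<longleftrightarrow> pos_def_mat p S \<and> S * S * A = 1\<^sub>m p"


definition cov_mat :: "nat \<Rightarrow> (nat \<Rightarrow> real) measure \<Rightarrow> real mat" where
  "cov_mat p P = Matrix.mat p p (\<lambda>(j, k).
     \<integral>x. (x j - (\<integral>z. z j \<partial>P)) * (x k - (\<integral>z. z k \<partial>P)) \<partial>P)"

text \<open>
  Condition on the common law \<open>P\<close> of the rows of the design. The exponential moment is a
  nonnegative integral, so the bound includes its finiteness.
\<close>

definition subgaussian_row_law ::
    "nat \<Rightarrow> real \<Rightarrow> real \<Rightarrow> real \<Rightarrow> (nat \<Rightarrow> real) measure \<Rightarrow> bool" where
  "subgaussian_row_law p \<kappa> c_min C_max P \<longleftrightarrow>
     prob_space P \<and> sets P = sets (vec_space p) \<and>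
     (\<forall>j<p. integrable P (\<lambda>x. (x j)\<^sup>2)) \<and>
     (\<forall>j<p. (\<integral>x. x j \<partial>P) = 0) \<and>
     c_min \<le> sigma_min (cov_mat p P) \<and>
     sigma_min (cov_mat p P) \<le> sigma_max (cov_mat p P) \<and>
     sigma_max (cov_mat p P) \<le> C_max \<and>
     (\<exists>S. is_inv_sqrt p (cov_mat p P) S \<and>
       (\<forall>\<alpha>\<in>carrier_vec p.
          (\<integral>\<^sup>+x. ennreal (exp (scalar_prod \<alpha> (S *\<^sub>v Matrix.vec p x))) \<partial>P)
            \<le> ennreal (exp (\<kappa>\<^sup>2 * scalar_prod \<alpha> \<alpha> / 2))))"

definition gaussian_noise :: "nat \<Rightarrow> real \<Rightarrow> (nat \<Rightarrow> real) measure" where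
  "gaussian_noise n \<sigma> = (\<Pi>\<^sub>M i\<in>{..<n}. density lborel (normal_density 0 \<sigma>))"

text \<open>
  Joint law of \<open>(X, \<epsilon>)\<close>: the rows of \<open>X\<close> are i.i.d. with law \<open>P\<close>, the entries of \<open>\<epsilon>\<close> are
  i.i.d. \<open>N(0, \<sigma>\<^sup>2)\<close>, and \<open>X\<close> and \<open>\<epsilon>\<close> are independent. Working with this law rather than with
  random variables keeps the constant of the lower bound independent of the sample space;
  the lemma below shows that nothing is lost.
\<close>

definition model_law ::
    "nat \<Rightarrow> (nat \<Rightarrow> real) measure \<Rightarrow> real \<Rightarrow> ((nat \<Rightarrow> nat \<Rightarrow> real) \<times> (nat \<Rightarrow> real)) measure" where
  "model_law n P \<sigma> = (\<Pi>\<^sub>M i\<in>{..<n}. P) \<Otimes>\<^sub>M gaussian_noise n \<sigma>"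

lemma (in prob_space) distr_eq_model_law:
  fixes X :: "nat \<Rightarrow> 'a \<Rightarrow> nat \<Rightarrow> real" and \<epsilon> :: "nat \<Rightarrow> 'a \<Rightarrow> real"
  assumes n: "1 \<le> n"
    and X: "indep_vars (\<lambda>_. vec_space p) X {..<n}"
    and P: "\<And>i. i < n \<Longrightarrow> distr M (vec_space p) (X i) = P"
    and \<epsilon>: "indep_vars (\<lambda>_. borel) \<epsilon> {..<n}"
    and N: "\<And>i. i < n \<Longrightarrow> distributed M lborel (\<epsilon> i) (normal_density 0 \<sigma>)"
    and ind: "indep_set
                {(\<lambda>\<omega>. \<lambda>i\<in>{..<n}. X i \<omega>) -` A \<inter> space M |A. A \<in> sets (design_space n p)}
                {(\<lambda>\<omega>. \<lambda>i\<in>{..<n}. \<epsilon> i \<omega>) -` B \<inter> space M |B. B \<in> sets (vec_space n)}"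
  shows "distr M (design_space n p \<Otimes>\<^sub>M vec_space n)
           (\<lambda>\<omega>. (\<lambda>i\<in>{..<n}. X i \<omega>, \<lambda>i\<in>{..<n}. \<epsilon> i \<omega>)) = model_law n P \<sigma>"
proof -
  have ne: "{..<n} \<noteq> {}" using n by (auto simp: lessThan_empty_iff)
  have rX: "random_variable (vec_space p) (X i)" if "i \<in> {..<n}" for i
    using X that by (simp add: indep_vars_def)
  have rE: "random_variable borel (\<epsilon> i)" if "i \<in> {..<n}" for i
    using \<epsilon> that by (simp add: indep_vars_def)
  have dX: "distr M (design_space n p) (\<lambda>\<omega>. \<lambda>i\<in>{..<n}. X i \<omega>) = (\<Pi>\<^sub>M i\<in>{..<n}. P)"
  proof -
    have "distr M (design_space n p) (\<lambda>\<omega>. \<lambda>i\<in>{..<n}. X i \<omega>)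
            = (\<Pi>\<^sub>M i\<in>{..<n}. distr M (vec_space p) (X i))"
      using indep_vars_iff_distr_eq_PiM'[where X = X and I = "{..<n}", OF ne rX] X by simp
    also have "\<dots> = (\<Pi>\<^sub>M i\<in>{..<n}. P)" by (rule PiM_cong) (use P in auto)
    finally show ?thesis .
  qed
  have eE: "distr M borel (\<epsilon> i) = density lborel (normal_density 0 \<sigma>)" if "i < n" for i
    using N[OF that] by (simp add: distributed_def cong: distr_cong)
  have dE: "distr M (vec_space n) (\<lambda>\<omega>. \<lambda>i\<in>{..<n}. \<epsilon> i \<omega>) = gaussian_noise n \<sigma>"
  proof -
    have "distr M (vec_space n) (\<lambda>\<omega>. \<lambda>i\<in>{..<n}. \<epsilon> i \<omega>)
            = (\<Pi>\<^sub>M i\<in>{..<n}. distr M borel (\<epsilon> i))"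
      using indep_vars_iff_distr_eq_PiM'[where X = \<epsilon> and I = "{..<n}", OF ne rE] \<epsilon> by simp
    also have "\<dots> = gaussian_noise n \<sigma>"
      unfolding gaussian_noise_def by (rule PiM_cong) (use eE in auto)
    finally show ?thesis .
  qed
  let ?X = "\<lambda>\<omega>. \<lambda>i\<in>{..<n}. X i \<omega>" and ?E = "\<lambda>\<omega>. \<lambda>i\<in>{..<n}. \<epsilon> i \<omega>"
  have mX: "?X \<in> measurable M (design_space n p)"
    using rX by (intro measurable_restrict) auto
  have mE: "?E \<in> measurable M (vec_space n)"
    using rE by (intro measurable_restrict) auto
  interpret DX: prob_space "distr M (design_space n p) ?X" by (rule prob_space_distr[OF mX])
  interpret DE: prob_space "distr M (vec_space n) ?E" by (rule prob_space_distr[OF mE])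
  have "distr M (design_space n p) ?X \<Otimes>\<^sub>M distr M (vec_space n) ?E
          = distr M (design_space n p \<Otimes>\<^sub>M vec_space n) (\<lambda>\<omega>. (?X \<omega>, ?E \<omega>))"
  proof (rule pair_measure_eqI)
    show "sigma_finite_measure (distr M (design_space n p) ?X)"
      and "sigma_finite_measure (distr M (vec_space n) ?E)" by unfold_locales
    show "sets (distr M (design_space n p) ?X \<Otimes>\<^sub>M distr M (vec_space n) ?E)
            = sets (distr M (design_space n p \<Otimes>\<^sub>M vec_space n) (\<lambda>\<omega>. (?X \<omega>, ?E \<omega>)))"
      by (simp cong: sets_pair_measure_cong)
    fix A B
    assume "A \<in> sets (distr M (design_space n p) ?X)" "B \<in> sets (distr M (vec_space n) ?E)"
    then have A: "A \<in> sets (design_space n p)" and B: "B \<in> sets (vec_space n)" by simp_all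
    have "prob ((?X -` A \<inter> space M) \<inter> (?E -` B \<inter> space M))
            = prob (?X -` A \<inter> space M) * prob (?E -` B \<inter> space M)"
      using ind A B by (intro indep_setD) auto
    moreover have "(\<lambda>\<omega>. (?X \<omega>, ?E \<omega>)) -` (A \<times> B) \<inter> space M
            = (?X -` A \<inter> space M) \<inter> (?E -` B \<inter> space M)" by blast
    ultimately show "emeasure (distr M (design_space n p) ?X) A * emeasure (distr M (vec_space n) ?E) B
            = emeasure (distr M (design_space n p \<Otimes>\<^sub>M vec_space n) (\<lambda>\<omega>. (?X \<omega>, ?E \<omega>))) (A \<times> B)"
      using A B mX mE
      by (simp only: emeasure_distr[OF mX A] emeasure_distr[OF mE B]
            emeasure_distr[OF measurable_Pair[OF mX mE] pair_measureI[OF A B]]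
            emeasure_eq_measure ennreal_mult'[symmetric] measure_nonneg)
  qed
  then show ?thesis unfolding dX dE model_law_def by simp
qed


definition response ::
    "nat \<Rightarrow> nat \<Rightarrow> (nat \<Rightarrow> nat \<Rightarrow> real) \<Rightarrow> (nat \<Rightarrow> real) \<Rightarrow> (nat \<Rightarrow> real) \<Rightarrow> nat \<Rightarrow> real" where
  "response n p X \<beta> e = (\<lambda>i\<in>{..<n}. (\<Sum>j<p. X i j * \<beta> j) + e i)"

definition estimators ::
    "nat \<Rightarrow> nat \<Rightarrow> ((nat \<Rightarrow> real) \<times> (nat \<Rightarrow> nat \<Rightarrow> real) \<Rightarrow> nat \<Rightarrow> real) set" where
  "estimators n p = measurable (vec_space n \<Otimes>\<^sub>M design_space n p) (vec_space p)"

text \<open>The risk takes the value \<open>\<infinity>\<close> when the squared error is not integrable.\<close>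

definition risk ::
    "nat \<Rightarrow> nat \<Rightarrow> (nat \<Rightarrow> real) measure \<Rightarrow> real \<Rightarrow>
     ((nat \<Rightarrow> real) \<times> (nat \<Rightarrow> nat \<Rightarrow> real) \<Rightarrow> nat \<Rightarrow> real) \<Rightarrow> (nat \<Rightarrow> real) \<Rightarrow> ennreal" where
  "risk n p P \<sigma> \<delta> \<beta> =
     (\<integral>\<^sup>+(X, e). ennreal ((L2_set (\<lambda>j. \<delta> (response n p X \<beta> e, X) j - \<beta> j) {..<p})\<^sup>2)
        \<partial>model_law n P \<sigma>)"


definition equal_groups :: "nat \<Rightarrow> nat \<Rightarrow> (nat \<Rightarrow> nat set) \<Rightarrow> bool" where
  "equal_groups d b G \<longleftrightarrow>
     disjoint_family_on G {..<d} \<and> (\<Union>k<d. G k) = {..<d * b} \<and> (\<forall>k<d. card (G k) = b)"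

definition l0_norm :: "nat \<Rightarrow> (nat \<Rightarrow> real) \<Rightarrow> nat" where
  "l0_norm p \<beta> = card {j. j < p \<and> \<beta> j \<noteq> 0}"

definition group_l0_norm :: "nat \<Rightarrow> (nat \<Rightarrow> nat set) \<Rightarrow> (nat \<Rightarrow> real) \<Rightarrow> nat" where
  "group_l0_norm d G \<beta> = card {k. k < d \<and> (\<exists>j\<in>G k. \<beta> j \<noteq> 0)}"

definition sparse_class ::
    "nat \<Rightarrow> nat \<Rightarrow> (nat \<Rightarrow> nat set) \<Rightarrow> nat \<Rightarrow> nat \<Rightarrow> (nat \<Rightarrow> real) set" where
  "sparse_class p d G s s\<^sub>g =
     {\<beta> \<in> {..<p} \<rightarrow>\<^sub>E UNIV. l0_norm p \<beta> \<le> s \<and> group_l0_norm d G \<beta> \<le> s\<^sub>g}"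

end

theory Submission
  imports Defs
begin

text \<open>
  No packing set is needed. Both terms of the rate come from the same prior: choose \<open>k\<close> disjoint
  blocks of \<open>m\<close> admissible coordinates and let \<open>\<beta>\<close> have, independently in every block, either no
  nonzero entry or a single entry \<open>\<tau>\<close> at one of the \<open>m\<close> places, all \<open>m + 1\<close> possibilities being
  equally likely. The Bayes risk is a sum over the blocks, and within a block, the others being
  revealed, one faces a testing problem between \<open>m + 1\<close> Gaussian shifts. Choosing
  \<open>\<tau>\<^sup>2\<close> of order \<open>\<sigma>\<^sup>2 ln (m + 1) / (C n)\<close>, with \<open>C\<close> a bound on the second moments of the design, makes
  the likelihood ratios too small to identify the shift, so every block costs a multiple of \<open>\<tau>\<^sup>2\<close>.
  Blocks of coordinates inside \<open>s\<^sub>g\<close> groups (\<open>k = s\<close>) give the within-group term, blocks with one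
  coordinate per group (\<open>k = s\<^sub>g\<close>) give the between-group term.
\<close>

subsection \<open>Diagonal entries and singular values\<close>

text \<open>The quadratic form attains its maximum on the compact unit sphere, and a maximiser is an
  eigenvector for the maximal value. This supplies a real eigenvalue of a symmetric matrix that
  dominates all Rayleigh quotients.\<close>

lemma rayleigh_maximum:
  fixes B :: "nat \<Rightarrow> nat \<Rightarrow> real"
  assumes p: "0 < p" and sym: "\<And>i j. i < p \<Longrightarrow> j < p \<Longrightarrow> B i j = B j i"
  obtains l x where "\<exists>i<p. x i \<noteq> 0" "\<And>i. i < p \<Longrightarrow> (\<Sum>j<p. B i j * x j) = l * x i"
    "\<And>v. (\<Sum>i<p. \<Sum>j<p. v i * B i j * v j) \<le> l * (\<Sum>i<p. (v i)\<^sup>2)"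
proof -
  define Q where "Q v w = (\<Sum>i<p. \<Sum>j<p. v i * B i j * w j)" for v w :: "nat \<Rightarrow> real"
  define N where "N v = (\<Sum>i<p. (v i)\<^sup>2)" for v :: "nat \<Rightarrow> real"
  \<comment> \<open>A product of compact sets, hence compact by Tychonoff; it contains every unit
    vector extended by zero from \<open>p\<close> on.\<close>
  define K where "K = PiE UNIV (\<lambda>i. if i < p then {-1..1::real} else {0})"
  have "compactin (product_topology (\<lambda>_. euclidean) UNIV) K"
    unfolding K_def by (subst compactin_PiE) auto
  then have K: "compact K" by (simp add: euclidean_product_topology)
  have contN: "continuous_on UNIV N" and contQ: "continuous_on UNIV (\<lambda>v. Q v v)"
    unfolding N_def Q_def by (intro continuous_intros continuous_on_product_coordinates)+
  have "closed (N -` {1})" using contN by (simp add: closed_vimage)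
  then have S: "compact (K \<inter> N -` {1})" using K by (rule compact_Int_closed[rotated])
  have "(\<lambda>i. if i = 0 then 1 else 0) \<in> K \<inter> N -` {1}"
    using p by (auto simp: K_def N_def if_distrib[of "\<lambda>z. z\<^sup>2"] sum.delta cong: if_cong)
  then have "K \<inter> N -` {1} \<noteq> {}" by blast
  then obtain x where x: "x \<in> K" "N x = 1" and max: "\<And>v. v \<in> K \<Longrightarrow> N v = 1 \<Longrightarrow> Q v v \<le> Q x x"
    using continuous_attains_sup[OF S _ continuous_on_subset[OF contQ]] by fastforce
  have homQ: "Q (\<lambda>i. c * v i) (\<lambda>i. c * w i) = c\<^sup>2 * Q v w" for c v w
    by (simp add: Q_def sum_distrib_left power2_eq_square algebra_simps)
  have homN: "N (\<lambda>i. c * v i) = c\<^sup>2 * N v" for c v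
    by (simp add: N_def sum_distrib_left power_mult_distrib)
  \<comment> \<open>Both sides are homogeneous of degree two, so \<open>v\<close> may be rescaled to
    the sphere, unless it vanishes below \<open>p\<close>. The rescaled \<open>w\<close> is cut off
    at \<open>p\<close> in order to lie in \<open>K\<close>.\<close>
  have le: "Q v v \<le> Q x x * N v" for v
  proof (cases "N v = 0")
    case True
    then have "\<forall>i<p. v i = 0" by (auto simp: N_def sum_nonneg_eq_0_iff)
    then have "Q v v = 0" by (simp add: Q_def)
    with True show ?thesis by simp
  next
    case False
    have N0: "N v > 0" using False sum_nonneg[of "{..<p}" "\<lambda>i. (v i)\<^sup>2"] by (simp add: N_def less_le)
    define w where "w i = (if i < p then v i / sqrt (N v) else 0)" for i
    have Qw: "Q w w = Q v v / N v" and Nw: "N w = 1"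
      using homQ[of "1 / sqrt (N v)" v v] homN[of "1 / sqrt (N v)" v] N0
      by (simp_all add: w_def Q_def N_def power_divide sum_nonneg)
    have "\<bar>w i\<bar> \<le> 1" if "i < p" for i
    proof -
      have "(w i)\<^sup>2 \<le> N w" unfolding N_def by (rule member_le_sum) (use that in auto)
      then show ?thesis using Nw by (simp add: abs_square_le_1)
    qed
    moreover have "w i = 0" if "\<not> i < p" for i using that by (simp add: w_def)
    ultimately have "w i \<in> (if i < p then {-1..1} else {0})" for i
      by (cases "i < p") (force simp: abs_le_iff)+
    then have "w \<in> K" unfolding K_def PiE_UNIV_domain by blast
    from max[OF this Nw] have "Q v v / N v \<le> Q x x" by (simp add: Qw)
    then show ?thesis using N0 by (simp add: field_simps)
  qed
  text \<open>A maximiser of the Rayleigh quotient is an eigenvector: perturb it in each coordinate direction.\<close>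
  have eig: "(\<Sum>j<p. B i j * x j) = Q x x * x i" if i: "i < p" for i
  proof -
    define g where "g = (\<Sum>j<p. B i j * x j) - Q x x * x i"
    define a where "a = B i i - Q x x"
    \<comment> \<open>Expand \<open>le\<close> at \<open>x + t * e\<close>: the constant terms
      cancel because \<open>N x = 1\<close>, and \<open>2 * g\<close> is what remains at first order
      in \<open>t\<close>.\<close>
    have quad: "2 * t * g + t\<^sup>2 * a \<le> 0" for t
    proof -
      define e where "e j = (if j = i then 1 else 0::real)" for j
      have esum: "(\<Sum>j<p. e j * f j) = f i" for f
        using i by (simp add: e_def if_distrib[of "\<lambda>z. z * _"] sum.delta cong: if_cong)
      have Qe: "Q e x = (\<Sum>j<p. B i j * x j)" "Q e e = B i i"
      proof -
        have "Q e w = (\<Sum>r<p. e r * (\<Sum>j<p. B r j * w j))" for w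
          by (simp add: Q_def sum_distrib_left mult.assoc)
        then have *: "Q e w = (\<Sum>j<p. B i j * w j)" for w by (simp add: esum)
        show "Q e x = (\<Sum>j<p. B i j * x j)" by (rule *)
        show "Q e e = B i i" using *[of e] esum[of "B i"] by (simp add: mult.commute)
      qed
      have "Q x e = Q e x"
        unfolding Q_def by (subst sum.swap) (auto intro!: sum.cong simp: sym)
      have 1: "Q (\<lambda>j. x j + t * e j) (\<lambda>j. x j + t * e j) = Q x x + 2 * t * Q e x + t\<^sup>2 * Q e e"
      proof -
        have "Q (\<lambda>j. x j + t * e j) (\<lambda>j. x j + t * e j) = Q x x + t * Q e x + t * Q x e + t\<^sup>2 * Q e e"
          by (simp add: Q_def algebra_simps sum.distrib sum_distrib_left power2_eq_square)
        then show ?thesis using \<open>Q x e = Q e x\<close> by simp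
      qed
      have ex: "(\<Sum>j<p. e j * x j) = x i" "(\<Sum>j<p. (e j)\<^sup>2) = 1"
        using esum[of x] esum[of e] by (simp_all add: e_def power2_eq_square)
      have "N (\<lambda>j. x j + t * e j) = N x + 2 * t * (\<Sum>j<p. e j * x j) + t\<^sup>2 * (\<Sum>j<p. (e j)\<^sup>2)"
        by (simp add: N_def algebra_simps sum.distrib sum_distrib_left power2_eq_square)
      then have 2: "N (\<lambda>j. x j + t * e j) = 1 + 2 * t * x i + t\<^sup>2" using ex x by simp
      show ?thesis using le[of "\<lambda>j. x j + t * e j"] unfolding 1 2 Qe
        by (simp add: g_def a_def algebra_simps)
    qed
    have "g = 0"
    proof (rule ccontr)
      assume g: "g \<noteq> 0"
      \<comment> \<open>Small enough for the linear term to dominate: the expression in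
        \<open>quad\<close> becomes \<open>t\<^sup>2 * (2 * (\<bar>a\<bar> + 1) + a)\<close>, which
        is positive.\<close>
      define t where "t = g / (\<bar>a\<bar> + 1)"
      have t: "t \<noteq> 0" "g = t * (\<bar>a\<bar> + 1)" using g by (auto simp: t_def)
      have "2 * t * g + t\<^sup>2 * a = t\<^sup>2 * (2 * (\<bar>a\<bar> + 1) + a)"
        unfolding t(2) by (simp add: algebra_simps power2_eq_square)
      moreover have "2 * (\<bar>a\<bar> + 1) + a > 0" by simp
      moreover have "t\<^sup>2 > 0" using t(1) by simp
      ultimately show False using quad[of t] by (metis mult_pos_pos not_less)
    qed
    then show ?thesis by (simp add: g_def)
  qed
  have "\<exists>i<p. x i \<noteq> 0" using x(2) by (auto simp: N_def intro: ccontr)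
  with eig le show ?thesis using that[of x "Q x x"] by (simp add: Q_def N_def)
qed

text \<open>The square of a diagonal entry is at most the squared norm of its column, which is the
  Rayleigh quotient of \<open>transpose_mat A * A\<close> at a unit vector and hence at most an
  eigenvalue of that matrix. For a covariance matrix this turns the spectral bound into bounds on
  variances.\<close>

lemma diag_le_sigma_max:
  assumes A: "A \<in> carrier_mat p p" and i: "i < p"
  shows "\<bar>A $$ (i, i)\<bar> \<le> sigma_max A"
proof -
  define B where "B = transpose_mat A * A"
  have B: "B \<in> carrier_mat p p" using A by (simp add: B_def)
  have Bij: "B $$ (r, q) = (\<Sum>k<p. A $$ (k, r) * A $$ (k, q))" if "r < p" "q < p" for r q
    using A that by (simp add: B_def scalar_prod_def lessThan_atLeast0)
  have sym: "B $$ (r, q) = B $$ (q, r)" if "r < p" "q < p" for r q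
    using that by (simp add: Bij mult.commute)
  obtain l x where x: "\<exists>r<p. x r \<noteq> 0" "\<And>r. r < p \<Longrightarrow> (\<Sum>q<p. B $$ (r, q) * x q) = l * x r"
    "\<And>v. (\<Sum>r<p. \<Sum>q<p. v r * B $$ (r, q) * v q) \<le> l * (\<Sum>r<p. (v r)\<^sup>2)"
    by (rule rayleigh_maximum[of p "\<lambda>r q. B $$ (r, q)", OF _ sym]) (use i in auto)
  have "eigenvector B (Matrix.vec p x) l"
    unfolding eigenvector_def
  proof (intro conjI)
    show "Matrix.vec p x \<in> carrier_vec (dim_row B)" using B by simp
    show "Matrix.vec p x \<noteq> 0\<^sub>v (dim_row B)" using B x(1) by (auto simp: vec_eq_iff)
    show "B *\<^sub>v Matrix.vec p x = l \<cdot>\<^sub>v Matrix.vec p x"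
    proof (rule eq_vecI)
      fix r assume "r < dim_vec (l \<cdot>\<^sub>v Matrix.vec p x)"
      then have r: "r < p" by simp
      have "(B *\<^sub>v Matrix.vec p x) $ r = (\<Sum>q<p. B $$ (r, q) * x q)"
        using r B by (simp add: scalar_prod_def lessThan_atLeast0)
      then show "(B *\<^sub>v Matrix.vec p x) $ r = (l \<cdot>\<^sub>v Matrix.vec p x) $ r"
        using r x(2) by simp
    qed (use B in simp)
  qed
  then have "l \<in> spectrum B" by (auto simp: spectrum_def eigenvalue_def)
  then have "sqrt l \<le> sigma_max A"
    unfolding sigma_max_def singular_values_def B_def[symmetric] using card_finite_spectrum(1)[OF B]
    by (intro Max_ge) auto
  moreover have "(A $$ (i, i))\<^sup>2 \<le> l"
  proof -
    have "(A $$ (i, i))\<^sup>2 \<le> (\<Sum>k<p. (A $$ (k, i))\<^sup>2)" by (rule member_le_sum) (use i in auto)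
    also have "\<dots> = B $$ (i, i)" using i by (simp add: Bij power2_eq_square)
    also have "\<dots> \<le> l"
      using x(3)[of "\<lambda>r. if r = i then 1 else 0"] i
      by (simp add: if_distrib[of "\<lambda>z. z * _"] if_distrib[of "\<lambda>z. _ * z"] if_distrib[of "\<lambda>z. z\<^sup>2"] sum.delta cong: if_cong)
    finally show ?thesis .
  qed
  ultimately show ?thesis using real_le_rsqrt[of "\<bar>A $$ (i, i)\<bar>" l] by simp
qed

subsection \<open>Shifts of Gaussian noise\<close>

text \<open>The density of the Gaussian law with mean \<open>h\<close> and independent entries of
  variance \<open>\<sigma>\<^sup>2\<close> with respect to the centred one.\<close>

definition likelihood_ratio :: "nat \<Rightarrow> real \<Rightarrow> (nat \<Rightarrow> real) \<Rightarrow> (nat \<Rightarrow> real) \<Rightarrow> real" where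
  "likelihood_ratio n \<sigma> h e = (\<Prod>i<n. exp (h i * e i / \<sigma>\<^sup>2 - (h i)\<^sup>2 / (2 * \<sigma>\<^sup>2)))"

lemma likelihood_ratio_pos: "0 < likelihood_ratio n \<sigma> h e"
  by (simp add: likelihood_ratio_def prod_pos)

lemma likelihood_ratio_zero: "likelihood_ratio n \<sigma> (\<lambda>_. 0) e = 1"
  by (simp add: likelihood_ratio_def)

lemma sets_gaussian_noise [simp, measurable_cong]: "sets (gaussian_noise n \<sigma>) = sets (vec_space n)"
  unfolding gaussian_noise_def by (intro sets_PiM_cong) auto

lemma space_gaussian_noise: "space (gaussian_noise n \<sigma>) = extensional {..<n}"
  by (simp add: gaussian_noise_def space_PiM PiE_def)

lemma prob_space_gaussian_noise: "0 < \<sigma> \<Longrightarrow> prob_space (gaussian_noise n \<sigma>)"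
  unfolding gaussian_noise_def by (intro prob_space_PiM prob_space_normal_density)

lemma likelihood_ratio_measurable [measurable]:
  "likelihood_ratio n \<sigma> h \<in> borel_measurable (vec_space n)"
  unfolding likelihood_ratio_def[abs_def] by measurable

lemma normal_density_tilt:
  assumes "0 < \<sigma>"
  shows "normal_density \<mu> \<sigma> x = normal_density 0 \<sigma> x * exp (\<mu> * x / \<sigma>\<^sup>2 - \<mu>\<^sup>2 / (2 * \<sigma>\<^sup>2))"
proof -
  have "- (x - \<mu>)\<^sup>2 / (2 * \<sigma>\<^sup>2) = - x\<^sup>2 / (2 * \<sigma>\<^sup>2) + (\<mu> * x / \<sigma>\<^sup>2 - \<mu>\<^sup>2 / (2 * \<sigma>\<^sup>2))"
    using assms by (simp add: field_simps power2_eq_square)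
  then show ?thesis unfolding normal_density_def by (simp only: exp_add mult.assoc diff_0_right)
qed

lemma product_sigma_finite_normal:
  "0 < \<sigma> \<Longrightarrow> product_sigma_finite (\<lambda>i. density lborel (\<lambda>x. ennreal (normal_density (\<mu> i) \<sigma> x)))"
  unfolding product_sigma_finite_def
  by (auto intro!: prob_space_imp_sigma_finite prob_space_normal_density)

text \<open>It suffices to compare the two measures on boxes. There the integral factorises, and
  each factor is a one-dimensional exponential tilt of the centred normal density.\<close>

lemma density_gaussian_noise:
  assumes \<sigma>: "0 < \<sigma>"
  shows "density (gaussian_noise n \<sigma>) (\<lambda>e. ennreal (likelihood_ratio n \<sigma> h e))
    = (\<Pi>\<^sub>M i\<in>{..<n}. density lborel (\<lambda>x. ennreal (normal_density (h i) \<sigma> x)))"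
proof (rule product_sigma_finite.PiM_eqI[OF product_sigma_finite_normal[OF \<sigma>]])
  interpret N: product_sigma_finite "\<lambda>i::nat. density lborel (\<lambda>x. ennreal (normal_density 0 \<sigma> x))"
    using product_sigma_finite_normal[OF \<sigma>, of "\<lambda>_. 0"] .
  show "sets (density (gaussian_noise n \<sigma>) (\<lambda>e. ennreal (likelihood_ratio n \<sigma> h e)))
    = sets (\<Pi>\<^sub>M i\<in>{..<n}. density lborel (\<lambda>x. ennreal (normal_density (h i) \<sigma> x)))"
    by (simp, intro sets_PiM_cong) auto
  fix A assume "\<And>i. i \<in> {..<n} \<Longrightarrow> A i \<in> sets (density lborel (\<lambda>x. ennreal (normal_density (h i) \<sigma> x)))"
  then have A [measurable]: "\<And>i. i \<in> {..<n} \<Longrightarrow> A i \<in> sets borel" by simp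
  define f where "f i x = ennreal (exp (h i * x / \<sigma>\<^sup>2 - (h i)\<^sup>2 / (2 * \<sigma>\<^sup>2))) * indicator (A i) x" for i x
  have f [measurable]: "f i \<in> borel_measurable borel" if "i \<in> {..<n}" for i
    unfolding f_def using A[OF that] by measurable
  have box: "Pi\<^sub>E {..<n} A \<in> sets (gaussian_noise n \<sigma>)"
    unfolding sets_gaussian_noise by (intro sets_PiM_I_finite) (auto intro: A)
  \<comment> \<open>Points of the space are extensional, so a point outside the box must violate it
    at some coordinate below \<open>n\<close>.\<close>
  have ind: "indicator (Pi\<^sub>E {..<n} A) e = (\<Prod>i<n. indicator (A i) (e i) :: ennreal)"
    if "e \<in> space (gaussian_noise n \<sigma>)" for e
  proof (cases "e \<in> Pi\<^sub>E {..<n} A")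
    case True
    then have "\<And>i. i < n \<Longrightarrow> e i \<in> A i" by (auto simp: PiE_iff)
    with True show ?thesis by simp
  next
    case False
    moreover have "e \<in> extensional {..<n}"
      using that by (simp add: space_gaussian_noise)
    ultimately obtain i where "i < n" "e i \<notin> A i" by (auto simp: PiE_def)
    then have "(\<Prod>i<n. indicator (A i) (e i) :: ennreal) = 0" 
      by (intro prod_zero bexI[of _ i]) auto
    with False show ?thesis by simp
  qed
  have "emeasure (density (gaussian_noise n \<sigma>) (\<lambda>e. ennreal (likelihood_ratio n \<sigma> h e))) (Pi\<^sub>E {..<n} A)
      = (\<integral>\<^sup>+e. ennreal (likelihood_ratio n \<sigma> h e) * indicator (Pi\<^sub>E {..<n} A) e \<partial>gaussian_noise n \<sigma>)"
    using box by (simp add: emeasure_density)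
  also have "\<dots> = (\<integral>\<^sup>+e. (\<Prod>i<n. f i (e i)) \<partial>gaussian_noise n \<sigma>)"
    by (intro nn_integral_cong)
      (simp add: ind likelihood_ratio_def f_def prod.distrib prod_ennreal)
  also have "\<dots> = (\<Prod>i<n. \<integral>\<^sup>+x. f i x \<partial>density lborel (\<lambda>x. ennreal (normal_density 0 \<sigma> x)))"
    unfolding gaussian_noise_def by (rule N.product_nn_integral_prod) (auto intro: f)
  also have "\<dots> = (\<Prod>i<n. emeasure (density lborel (\<lambda>x. ennreal (normal_density (h i) \<sigma> x))) (A i))"
  proof (intro prod.cong refl)
    fix i assume i: "i \<in> {..<n}"
    have "(\<integral>\<^sup>+x. f i x \<partial>density lborel (\<lambda>x. ennreal (normal_density 0 \<sigma> x)))
      = (\<integral>\<^sup>+x. ennreal (normal_density 0 \<sigma> x) * f i x \<partial>lborel)"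
      using f[OF i] by (intro nn_integral_density) auto
    also have "\<dots> = (\<integral>\<^sup>+x. ennreal (normal_density (h i) \<sigma> x) * indicator (A i) x \<partial>lborel)"
      by (subst (2) normal_density_tilt[OF \<sigma>]) (simp add: f_def ennreal_mult mult.assoc)
    also have "\<dots> = emeasure (density lborel (\<lambda>x. ennreal (normal_density (h i) \<sigma> x))) (A i)"
      using A[OF i] by (simp add: emeasure_density)
    finally show "(\<integral>\<^sup>+x. f i x \<partial>density lborel (\<lambda>x. ennreal (normal_density 0 \<sigma> x)))
      = emeasure (density lborel (\<lambda>x. ennreal (normal_density (h i) \<sigma> x))) (A i)" .
  qed
  finally show "emeasure (density (gaussian_noise n \<sigma>) (\<lambda>e. ennreal (likelihood_ratio n \<sigma> h e))) (Pi\<^sub>E {..<n} A)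
      = (\<Prod>i<n. emeasure (density lborel (\<lambda>x. ennreal (normal_density (h i) \<sigma> x))) (A i))" .
qed simp

text \<open>Again checked on boxes: the preimage of a box is a box with translated sides, and
  Lebesgue measure is translation invariant.\<close>

lemma distr_gaussian_noise_shift:
  assumes \<sigma>: "0 < \<sigma>"
  shows "distr (gaussian_noise n \<sigma>) (vec_space n) (\<lambda>e. \<lambda>i\<in>{..<n}. e i + h i)
    = (\<Pi>\<^sub>M i\<in>{..<n}. density lborel (\<lambda>x. ennreal (normal_density (h i) \<sigma> x)))"
proof (rule product_sigma_finite.PiM_eqI[OF product_sigma_finite_normal[OF \<sigma>]])
  interpret N: product_sigma_finite "\<lambda>i::nat. density lborel (\<lambda>x. ennreal (normal_density 0 \<sigma> x))"
    using product_sigma_finite_normal[OF \<sigma>, of "\<lambda>_. 0"] .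
  show "sets (distr (gaussian_noise n \<sigma>) (vec_space n) (\<lambda>e. \<lambda>i\<in>{..<n}. e i + h i))
    = sets (\<Pi>\<^sub>M i\<in>{..<n}. density lborel (\<lambda>x. ennreal (normal_density (h i) \<sigma> x)))"
    by (simp, intro sets_PiM_cong) auto
  fix A assume "\<And>i. i \<in> {..<n} \<Longrightarrow> A i \<in> sets (density lborel (\<lambda>x. ennreal (normal_density (h i) \<sigma> x)))"
  then have A: "\<And>i. i \<in> {..<n} \<Longrightarrow> A i \<in> sets borel" by simp
  define A' where "A' i = (\<lambda>x. x + h i) -` A i" for i
  have A' [measurable]: "A' i \<in> sets borel" if "i \<in> {..<n}" for i
    using measurable_sets[OF _ A[OF that], of "\<lambda>x. x + h i" borel] by (simp add: A'_def)
  have m: "(\<lambda>e. \<lambda>i\<in>{..<n}. e i + h i) \<in> measurable (gaussian_noise n \<sigma>) (vec_space n)"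
    by measurable
  have "emeasure (distr (gaussian_noise n \<sigma>) (vec_space n) (\<lambda>e. \<lambda>i\<in>{..<n}. e i + h i)) (Pi\<^sub>E {..<n} A)
     = emeasure (gaussian_noise n \<sigma>) ((\<lambda>e. \<lambda>i\<in>{..<n}. e i + h i) -` Pi\<^sub>E {..<n} A \<inter> space (gaussian_noise n \<sigma>))"
    by (intro emeasure_distr m sets_PiM_I_finite) (auto intro: A)
  also have "(\<lambda>e. \<lambda>i\<in>{..<n}. e i + h i) -` Pi\<^sub>E {..<n} A \<inter> space (gaussian_noise n \<sigma>) = Pi\<^sub>E {..<n} A'"
  proof (rule Set.set_eqI)
    fix e
    show "e \<in> (\<lambda>e. \<lambda>i\<in>{..<n}. e i + h i) -` Pi\<^sub>E {..<n} A \<inter> space (gaussian_noise n \<sigma>) \<longleftrightarrow> e \<in> Pi\<^sub>E {..<n} A'"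
      unfolding space_gaussian_noise PiE_def A'_def by (simp add: Pi_iff)
  qed
  also have "emeasure (gaussian_noise n \<sigma>) (Pi\<^sub>E {..<n} A')
     = (\<Prod>i<n. emeasure (density lborel (\<lambda>x. ennreal (normal_density 0 \<sigma> x))) (A' i))"
    unfolding gaussian_noise_def by (rule N.emeasure_PiM) (auto intro: A')
  also have "\<dots> = (\<Prod>i<n. emeasure (density lborel (\<lambda>x. ennreal (normal_density (h i) \<sigma> x))) (A i))"
  proof (intro prod.cong refl)
    fix i assume i: "i \<in> {..<n}"
    note [measurable] = A[OF i] A'[OF i]
    have "emeasure (density lborel (\<lambda>x. ennreal (normal_density (h i) \<sigma> x))) (A i)
      = (\<integral>\<^sup>+x. ennreal (normal_density (h i) \<sigma> x) * indicator (A i) x \<partial>lborel)"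
      by (simp add: emeasure_density)
    also have "\<dots> = (\<integral>\<^sup>+x. ennreal (normal_density (h i) \<sigma> (h i + 1 * x)) * indicator (A i) (h i + 1 * x) \<partial>lborel)"
      by (subst nn_integral_real_affine[where c=1 and t="h i"]) auto
    also have "\<dots> = (\<integral>\<^sup>+x. ennreal (normal_density 0 \<sigma> x) * indicator (A' i) x \<partial>lborel)"
      by (intro nn_integral_cong) (auto simp: normal_density_def A'_def indicator_def add.commute)
    also have "\<dots> = emeasure (density lborel (\<lambda>x. ennreal (normal_density 0 \<sigma> x))) (A' i)"
      by (simp add: emeasure_density)
    finally show "emeasure (density lborel (\<lambda>x. ennreal (normal_density 0 \<sigma> x))) (A' i)
      = emeasure (density lborel (\<lambda>x. ennreal (normal_density (h i) \<sigma> x))) (A i)" ..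
  qed
  finally show "emeasure (distr (gaussian_noise n \<sigma>) (vec_space n) (\<lambda>e. \<lambda>i\<in>{..<n}. e i + h i)) (Pi\<^sub>E {..<n} A)
      = (\<Prod>i<n. emeasure (density lborel (\<lambda>x. ennreal (normal_density (h i) \<sigma> x))) (A i))" .
qed simp

text \<open>The two descriptions of the shifted law combine to a change of measure: shifting the
  observation amounts to weighting by the likelihood ratio. All hypotheses can then be compared
  under one noise law.\<close>

lemma nn_integral_gaussian_noise_shift:
  assumes \<sigma>: "0 < \<sigma>" and g [measurable]: "g \<in> borel_measurable (vec_space n)"
  shows "(\<integral>\<^sup>+e. g (\<lambda>i\<in>{..<n}. e i + h i) \<partial>gaussian_noise n \<sigma>)
    = (\<integral>\<^sup>+e. ennreal (likelihood_ratio n \<sigma> h e) * g e \<partial>gaussian_noise n \<sigma>)"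
proof -
  have "(\<integral>\<^sup>+e. g (\<lambda>i\<in>{..<n}. e i + h i) \<partial>gaussian_noise n \<sigma>)
    = (\<integral>\<^sup>+e. g e \<partial>distr (gaussian_noise n \<sigma>) (vec_space n) (\<lambda>e. \<lambda>i\<in>{..<n}. e i + h i))"
    by (rule nn_integral_distr[symmetric]) measurable
  also have "\<dots> = (\<integral>\<^sup>+e. g e \<partial>density (gaussian_noise n \<sigma>) (\<lambda>e. ennreal (likelihood_ratio n \<sigma> h e)))"
    by (simp only: distr_gaussian_noise_shift[OF \<sigma>] density_gaussian_noise[OF \<sigma>])
  also have "\<dots> = (\<integral>\<^sup>+e. ennreal (likelihood_ratio n \<sigma> h e) * g e \<partial>gaussian_noise n \<sigma>)"
    by (rule nn_integral_density) measurable
  finally show ?thesis .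
qed

section \<open>Moments of likelihood ratios and the testing bound\<close>

lemma nn_integral_likelihood_ratio:
  assumes "0 < \<sigma>"
  shows "(\<integral>\<^sup>+e. ennreal (likelihood_ratio n \<sigma> h e) \<partial>gaussian_noise n \<sigma>) = 1"
  using nn_integral_gaussian_noise_shift[OF assms, of "\<lambda>_. 1" n h]
    prob_space.emeasure_space_1[OF prob_space_gaussian_noise[OF assms]] by simp

text \<open>Squaring doubles the linear part of the exponent, as passing from \<open>h\<close> to
  \<open>2 * h\<close> does; the two quadratic parts differ by the exponential factor. Since
  likelihood ratios have mean one, that factor is the second moment.\<close>

lemma likelihood_ratio_power2:
  "(likelihood_ratio n \<sigma> h e)\<^sup>2
    = exp ((\<Sum>i<n. (h i)\<^sup>2) / \<sigma>\<^sup>2) * likelihood_ratio n \<sigma> (\<lambda>i. 2 * h i) e"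
  unfolding likelihood_ratio_def
  by (simp add: sum_divide_distrib exp_sum prod_power_distrib prod.distrib[symmetric]
      exp_double[symmetric] exp_add[symmetric])
    (intro prod.cong refl, simp add: field_simps power2_eq_square)

text \<open>
  From \<open>min L T \<ge> L - L\<^sup>2 / (4 T)\<close> and \<open>E L\<^sup>2 = exp v\<close>. The bound is put in a form linear in \<open>v\<close> because
  \<open>v\<close> will be random, with only its mean under control.
\<close>

lemma nn_integral_truncated_likelihood_ratio:
  fixes n :: nat and h :: "nat \<Rightarrow> real" and \<theta> :: real
  assumes \<sigma>: "0 < \<sigma>" and T: "0 < T"
    and \<theta>: "0 \<le> \<theta>" "exp V / (4 * T) \<le> 1 - \<theta>" and V: "0 < V"
  defines "v \<equiv> (\<Sum>i<n. (h i)\<^sup>2) / \<sigma>\<^sup>2"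
  shows "ennreal \<theta> \<le> (\<integral>\<^sup>+e. ennreal (min (likelihood_ratio n \<sigma> h e) T) \<partial>gaussian_noise n \<sigma>)
    + ennreal (\<theta> * v / V)"
proof (cases "v \<le> V")
  \<comment> \<open>For \<open>v > V\<close> the last term on the right is by itself at least
    \<open>\<theta>\<close>.\<close>
  case False
  then have "\<theta> \<le> \<theta> * v / V" 
    using V mult_left_mono[of V v \<theta>] \<theta>(1) by (simp add: pos_le_divide_eq)
  from ennreal_leI[OF this] show ?thesis by (simp add: add_increasing)
next
  case True
  let ?L = "likelihood_ratio n \<sigma> h" and ?I = "\<integral>\<^sup>+e. ennreal (min (likelihood_ratio n \<sigma> h e) T) \<partial>gaussian_noise n \<sigma>"
  \<comment> \<open>If the minimum is \<open>T\<close>, this is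
    \<open>(x - 2 * T)\<^sup>2 \<ge> 0\<close> divided by \<open>4 * T\<close>; otherwise it is
    trivial.\<close>
  have le: "x \<le> min x T + x\<^sup>2 / (4 * T)" for x
  proof -
    have "x * (4 * T) \<le> T * (4 * T) + x\<^sup>2"
      using zero_le_power2[of "x - 2 * T"] by (simp add: power2_eq_square algebra_simps)
    then have "x \<le> T + x\<^sup>2 / (4 * T)" using T by (simp add: field_simps)
    moreover have "0 \<le> x\<^sup>2 / (4 * T)" using T by simp
    ultimately show ?thesis by linarith
  qed
  have le': "?L e \<le> min (?L e) T + exp v / (4 * T) * likelihood_ratio n \<sigma> (\<lambda>i. 2 * h i) e" for e
    using le[of "?L e"] by (simp add: likelihood_ratio_power2[of n \<sigma> h e] v_def)
  have "1 = (\<integral>\<^sup>+e. ennreal (?L e) \<partial>gaussian_noise n \<sigma>)"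
    using nn_integral_likelihood_ratio[OF \<sigma>] by simp
  also have "\<dots> \<le> (\<integral>\<^sup>+e. ennreal (min (?L e) T)
      + ennreal (exp v / (4 * T)) * ennreal (likelihood_ratio n \<sigma> (\<lambda>i. 2 * h i) e) \<partial>gaussian_noise n \<sigma>)"
    using T le' likelihood_ratio_pos[of n \<sigma> h] likelihood_ratio_pos[of n \<sigma> "\<lambda>i. 2 * h i"]
    by (intro nn_integral_mono)
      (simp add: ennreal_mult[symmetric] ennreal_plus[symmetric] less_imp_le del: ennreal_plus times_divide_eq_left)
  also have "\<dots> = ?I + ennreal (exp v / (4 * T)) * 1"
    by (subst nn_integral_add, measurable) (simp add: nn_integral_cmult nn_integral_likelihood_ratio[OF \<sigma>])
  finally have 1: "1 \<le> ?I + ennreal (exp v / (4 * T))" by simp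
  have "exp v / (4 * T) \<le> 1 - \<theta>"
    using True \<theta> T by (intro order_trans[OF _ \<theta>(2)] divide_right_mono) auto
  then have "ennreal (exp v / (4 * T)) \<le> ennreal (1 - \<theta>)" by (rule ennreal_leI)
  with 1 have "1 \<le> ?I + ennreal (1 - \<theta>)" by (meson add_left_mono order_trans)
  moreover have "ennreal \<theta> + ennreal (1 - \<theta>) = 1"
    using \<theta>(1) order_trans[OF _ \<theta>(2), of 0] T by (subst ennreal_plus[symmetric]) auto
  ultimately have "ennreal \<theta> + ennreal (1 - \<theta>) \<le> ?I + ennreal (1 - \<theta>)" by simp
  then have "ennreal \<theta> \<le> ?I" by (simp add: ennreal_add_left_cancel_le add.commute)
  then show ?thesis by (simp add: add_increasing2)
qed

text \<open>
  Replacing every likelihood ratio by its truncation at \<open>T\<close> costs only an inequality, and since at most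
  one loss is below \<open>q\<close>, the weighted sum of the losses is at least \<open>q\<close> times the total weight
  minus \<open>T\<close>.
\<close>

lemma testing_lower_bound:
  fixes loss :: "'j \<Rightarrow> (nat \<Rightarrow> real) \<Rightarrow> real" and h :: "'j \<Rightarrow> nat \<Rightarrow> real" and q \<theta> :: real
  assumes \<sigma>: "0 < \<sigma>" and T: "1 \<le> T" and V: "0 < V"
    and \<theta>: "0 \<le> \<theta>" "exp V / (4 * T) \<le> 1 - \<theta>" and q: "0 \<le> q"
    and I: "finite I" "z \<in> I" and h0: "\<And>i. h z i = 0"
    and loss [measurable]: "\<And>j. j \<in> I \<Longrightarrow> loss j \<in> borel_measurable (vec_space n)"
    and nonneg: "\<And>j y. 0 \<le> loss j y"
    and sep: "\<And>i j y. i \<in> I \<Longrightarrow> j \<in> I \<Longrightarrow> loss i y < q \<Longrightarrow> loss j y < q \<Longrightarrow> i = j"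
  shows "ennreal (q * (1 + \<theta> * card (I - {z})))
    \<le> (\<Sum>j\<in>I. \<integral>\<^sup>+e. ennreal (loss j (\<lambda>i\<in>{..<n}. e i + h j i)) \<partial>gaussian_noise n \<sigma>)
      + ennreal (q * T) + (\<Sum>j\<in>I - {z}. ennreal (q * (\<theta> * ((\<Sum>i<n. (h j i)\<^sup>2) / \<sigma>\<^sup>2) / V)))"
proof -
  let ?\<gamma> = "gaussian_noise n \<sigma>"
  define w where "w j e = min (likelihood_ratio n \<sigma> (h j) e) T" for j e
  define v where "v j = (\<Sum>i<n. (h j i)\<^sup>2) / \<sigma>\<^sup>2" for j
  have w: "0 \<le> w j e" "w j e \<le> T" for j e
    using T likelihood_ratio_pos[of n \<sigma> "h j" e] by (auto simp: w_def)
  have v: "0 \<le> v j" for j by (simp add: v_def sum_nonneg)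
  have wm [measurable]: "w j \<in> borel_measurable (vec_space n)" for j
    unfolding w_def[abs_def] by measurable
  have "h z = (\<lambda>_. 0)" using h0 by auto
  then have wz: "w z e = 1" for e using T by (simp add: w_def likelihood_ratio_zero)
  have pt: "q * (\<Sum>j\<in>I. w j e) \<le> (\<Sum>j\<in>I. w j e * loss j e) + q * T" for e
  proof (cases "\<exists>i\<in>I. loss i e < q")
    case True
    then obtain i where i: "i \<in> I" "loss i e < q" by blast
    have "q * (\<Sum>j\<in>I - {i}. w j e) \<le> (\<Sum>j\<in>I - {i}. w j e * loss j e)"
      unfolding sum_distrib_left
    proof (rule sum_mono)
      fix j assume "j \<in> I - {i}"
      then have "q \<le> loss j e" using sep[OF i(1), of j e] i(2) by force
      then show "q * w j e \<le> w j e * loss j e"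
        using mult_right_mono[OF _ w(1), of q "loss j e" j e] by (simp add: mult.commute)
    qed
    moreover have "q * w i e \<le> q * T" using w q by (simp add: mult_left_mono)
    moreover have "0 \<le> w i e * loss i e" using w nonneg by simp
    ultimately show ?thesis using I i by (simp add: sum.remove[of I i] algebra_simps)
  next
    case False
    then have "q * (\<Sum>j\<in>I. w j e) \<le> (\<Sum>j\<in>I. w j e * loss j e)"
      unfolding sum_distrib_left using mult_right_mono[OF _ w(1), of q "loss _ e" _ e]
      by (intro sum_mono) (simp add: mult.commute not_less)
    moreover have "0 \<le> q * T" using q T by simp
    ultimately show ?thesis by linarith
  qed
  \<comment> \<open>The index \<open>z\<close> has total weight one, because its likelihood ratio is
    constantly one and \<open>1 \<le> T\<close>. Every other index has weight at least
    \<open>\<theta>\<close>, up to the error term in \<open>v j\<close>.\<close>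
  have "ennreal (q * (1 + \<theta> * card (I - {z}))) = ennreal q * (1 + (\<Sum>j\<in>I - {z}. ennreal \<theta>))"
    using q \<theta> by (simp add: ennreal_mult ennreal_of_nat_eq_real_of_nat mult.commute)
  also have "\<dots> \<le> ennreal q * ((\<integral>\<^sup>+e. ennreal (w z e) \<partial>?\<gamma>)
      + (\<Sum>j\<in>I - {z}. (\<integral>\<^sup>+e. ennreal (w j e) \<partial>?\<gamma>) + ennreal (\<theta> * v j / V)))"
  proof (intro mult_left_mono add_mono sum_mono)
    show "1 \<le> (\<integral>\<^sup>+e. ennreal (w z e) \<partial>?\<gamma>)"
      using prob_space.emeasure_space_1[OF prob_space_gaussian_noise[OF \<sigma>]] by (simp add: wz)
    show "ennreal \<theta> \<le> (\<integral>\<^sup>+e. ennreal (w j e) \<partial>?\<gamma>) + ennreal (\<theta> * v j / V)" for j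
      unfolding w_def v_def
      by (rule nn_integral_truncated_likelihood_ratio) (use \<sigma> T V \<theta> in auto)
  qed simp
  also have "\<dots> = ennreal q * (\<Sum>j\<in>I. \<integral>\<^sup>+e. ennreal (w j e) \<partial>?\<gamma>)
      + (\<Sum>j\<in>I - {z}. ennreal (q * (\<theta> * v j / V)))"
  proof -
    have "ennreal (q * (\<theta> * v j / V)) = ennreal q * ennreal (\<theta> * v j / V)" for j
      using q \<theta>(1) V v[of j] by (intro ennreal_mult) auto
    then show ?thesis
      unfolding sum.remove[OF I] by (simp only: sum.distrib sum_distrib_left distrib_left add.assoc)
  qed
  also have "ennreal q * (\<Sum>j\<in>I. \<integral>\<^sup>+e. ennreal (w j e) \<partial>?\<gamma>)
      = (\<integral>\<^sup>+e. ennreal (q * (\<Sum>j\<in>I. w j e)) \<partial>?\<gamma>)"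
  proof -
    have "ennreal q * (\<Sum>j\<in>I. \<integral>\<^sup>+e. ennreal (w j e) \<partial>?\<gamma>)
      = (\<integral>\<^sup>+e. ennreal q * (\<Sum>j\<in>I. ennreal (w j e)) \<partial>?\<gamma>)"
      by (subst nn_integral_cmult, measurable) (subst nn_integral_sum, measurable)
    also have "\<dots> = (\<integral>\<^sup>+e. ennreal (q * (\<Sum>j\<in>I. w j e)) \<partial>?\<gamma>)"
      using q w(1) by (intro nn_integral_cong) (simp add: ennreal_mult sum_nonneg)
    finally show ?thesis .
  qed
  also have "\<dots> \<le> (\<integral>\<^sup>+e. (\<Sum>j\<in>I. ennreal (w j e) * ennreal (loss j e)) + ennreal (q * T) \<partial>?\<gamma>)"
    using pt w nonneg q T
    by (intro nn_integral_mono)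
      (simp add: ennreal_mult[symmetric] sum_nonneg ennreal_plus[symmetric] del: ennreal_plus)
  also have "\<dots> = (\<Sum>j\<in>I. \<integral>\<^sup>+e. ennreal (w j e) * ennreal (loss j e) \<partial>?\<gamma>) + ennreal (q * T)"
    using prob_space.emeasure_space_1[OF prob_space_gaussian_noise[OF \<sigma>]]
    by (subst nn_integral_add, measurable) (simp add: nn_integral_sum)
  \<comment> \<open>The truncation is dropped again, and the likelihood ratio is absorbed into a
    shift of the observation.\<close>
  also have "\<dots> \<le> (\<Sum>j\<in>I. \<integral>\<^sup>+e. ennreal (loss j (\<lambda>i\<in>{..<n}. e i + h j i)) \<partial>?\<gamma>) + ennreal (q * T)"
  proof (intro add_mono sum_mono order_refl)
    fix j assume j: "j \<in> I"
    have "(\<integral>\<^sup>+e. ennreal (w j e) * ennreal (loss j e) \<partial>?\<gamma>)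
      \<le> (\<integral>\<^sup>+e. ennreal (likelihood_ratio n \<sigma> (h j) e) * ennreal (loss j e) \<partial>?\<gamma>)"
      by (intro nn_integral_mono mult_right_mono ennreal_leI) (auto simp: w_def)
    also have "\<dots> = (\<integral>\<^sup>+e. ennreal (loss j (\<lambda>i\<in>{..<n}. e i + h j i)) \<partial>?\<gamma>)"
      by (intro nn_integral_gaussian_noise_shift[OF \<sigma>, symmetric] measurable_compose[OF loss[OF j] measurable_ennreal])
    finally show "(\<integral>\<^sup>+e. ennreal (w j e) * ennreal (loss j e) \<partial>?\<gamma>)
      \<le> (\<integral>\<^sup>+e. ennreal (loss j (\<lambda>i\<in>{..<n}. e i + h j i)) \<partial>?\<gamma>)" .
  qed
  finally show ?thesis by (simp add: v_def add_right_mono)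
qed

subsection \<open>Risk on blocks of coordinates\<close>

text \<open>The rows are centred, so the second moment is a diagonal entry of the covariance matrix
  and is bounded by its largest singular value.\<close>

lemma subgaussian_second_moment_le:
  assumes "subgaussian_row_law p \<kappa> c_min C_max P" and j: "j < p"
  shows "(\<integral>\<^sup>+x. ennreal ((x j)\<^sup>2) \<partial>P) \<le> ennreal C_max"
proof -
  have int: "integrable P (\<lambda>x. (x j)\<^sup>2)" and mean: "(\<integral>x. x j \<partial>P) = 0"
    and le: "sigma_max (cov_mat p P) \<le> C_max"
    using assms by (auto simp: subgaussian_row_law_def)
  have "cov_mat p P \<in> carrier_mat p p" by (simp add: cov_mat_def)
  from diag_le_sigma_max[OF this j] le have "\<bar>cov_mat p P $$ (j, j)\<bar> \<le> C_max" by simp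
  moreover have "cov_mat p P $$ (j, j) = (\<integral>x. (x j)\<^sup>2 \<partial>P)"
    using j mean by (simp add: cov_mat_def power2_eq_square)
  ultimately show ?thesis
    using nn_integral_eq_integral[OF int] by (simp add: ennreal_leI)
qed

text \<open>Moves a finite term across an inequality in which the risk \<open>S\<close> may be
  infinite.\<close>

lemma ennreal_diff_le:
  assumes "ennreal a \<le> S + ennreal b" "0 \<le> b"
  shows "ennreal (a - b) \<le> S"
proof (cases S)
  case (real s)
  then have "ennreal a \<le> ennreal (s + b)" using assms by simp
  then have "a \<le> s + b" using real(1) assms(2) by (subst (asm) ennreal_le_iff) auto
  then show ?thesis using real by (simp add: ennreal_leI)
qed simp

text \<open>The share of the risk that falls on the coordinates in \<open>S\<close>. The estimator
  still uses the whole response and design; only the loss is restricted.\<close>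

definition coord_risk ::
    "nat \<Rightarrow> nat \<Rightarrow> (nat \<Rightarrow> real) measure \<Rightarrow> real \<Rightarrow>
     ((nat \<Rightarrow> real) \<times> (nat \<Rightarrow> nat \<Rightarrow> real) \<Rightarrow> nat \<Rightarrow> real) \<Rightarrow> nat set \<Rightarrow> (nat \<Rightarrow> real) \<Rightarrow> ennreal" where
  "coord_risk n p P \<sigma> \<delta> S \<beta> =
     (\<integral>\<^sup>+(X, e). ennreal (\<Sum>i\<in>S. (\<delta> (response n p X \<beta> e, X) i - \<beta> i)\<^sup>2) \<partial>model_law n P \<sigma>)"

text \<open>Block \<open>l\<close> consists of the places \<open>c (l * m + r)\<close> with
  \<open>r < m\<close>, and \<open>J l\<close> picks the place that receives \<open>\<tau>\<close>.
  The value \<open>J l = m\<close> leaves the block empty.\<close>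

definition block_vector :: "nat \<Rightarrow> nat \<Rightarrow> nat \<Rightarrow> real \<Rightarrow> (nat \<Rightarrow> nat) \<Rightarrow> (nat \<Rightarrow> nat) \<Rightarrow> nat \<Rightarrow> real" where
  "block_vector p k m \<tau> c J = (\<lambda>i\<in>{..<p}. \<Sum>l<k. if J l < m \<and> i = c (l * m + J l) then \<tau> else 0)"

text \<open>Conditioning on all indices but \<open>l\<close>: every \<open>J\<close> arises in
  exactly one way from a choice on the other blocks and a value at \<open>l\<close>. The uniform
  average appears as a sum with the cardinality on the other side, which avoids division in
  \<open>ennreal\<close>.\<close>

lemma sum_PiE_ge:
  fixes f :: "(nat \<Rightarrow> nat) \<Rightarrow> ennreal"
  assumes l: "l < k" and ge: "\<And>J. of_nat (m + 1) * a \<le> (\<Sum>j\<le>m. f (J(l := j)))"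
  shows "of_nat (card ({..<k} \<rightarrow>\<^sub>E {..m})) * a \<le> (\<Sum>J\<in>{..<k} \<rightarrow>\<^sub>E {..m}. f J)"
proof -
  define A where "A = ({..<k} - {l}) \<rightarrow>\<^sub>E {..m}"
  have ins: "insert l ({..<k} - {l}) = {..<k}" using l by auto
  have eq: "{..<k} \<rightarrow>\<^sub>E {..m} = (\<lambda>(j, g). g(l := j)) ` ({..m} \<times> A)"
    using PiE_insert_eq[of l "{..<k} - {l}" "\<lambda>_. {..m}"] by (simp only: ins A_def)
  have inj: "inj_on (\<lambda>(j, g). g(l := j)) ({..m} \<times> A)"
    using inj_combinator[of l "{..<k} - {l}" "\<lambda>_. {..m}"] by (simp add: A_def)
  have "of_nat (card ({..<k} \<rightarrow>\<^sub>E {..m})) * a = (\<Sum>J\<in>A. of_nat (m + 1) * a)"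
    unfolding eq card_image[OF inj] by (simp add: card_cartesian_product algebra_simps)
  also have "\<dots> \<le> (\<Sum>J\<in>A. \<Sum>j\<le>m. f (J(l := j)))" by (intro sum_mono ge)
  also have "\<dots> = (\<Sum>(j, J)\<in>{..m} \<times> A. f (J(l := j)))"
    by (subst sum.swap) (rule sum.cartesian_product)
  also have "\<dots> = (\<Sum>J\<in>{..<k} \<rightarrow>\<^sub>E {..m}. f J)"
    unfolding eq sum.reindex[OF inj] by (simp add: case_prod_beta)
  finally show ?thesis .
qed

section \<open>Lower bounds for a fixed estimator under bounded second moments\<close>

context
  fixes n p :: nat and P :: "(nat \<Rightarrow> real) measure" and \<sigma> C :: real
    and \<delta> :: "(nat \<Rightarrow> real) \<times> (nat \<Rightarrow> nat \<Rightarrow> real) \<Rightarrow> nat \<Rightarrow> real"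
  assumes \<sigma>: "0 < \<sigma>" and n: "1 \<le> n" and C: "0 < C"
    and prob_P: "prob_space P" and sets_P: "sets P = sets (vec_space p)"
    and second_moment: "\<And>j. j < p \<Longrightarrow> (\<integral>\<^sup>+x. ennreal ((x j)\<^sup>2) \<partial>P) \<le> ennreal C"
    and \<delta>: "\<delta> \<in> estimators n p"
begin

lemma sets_rows: "sets (\<Pi>\<^sub>M i\<in>{..<n}. P) = sets (design_space n p)"
  by (intro sets_PiM_cong) (auto simp: sets_P)

lemma prob_space_rows: "prob_space (\<Pi>\<^sub>M i\<in>{..<n}. P)"
  by (intro prob_space_PiM prob_P)

lemma estimator_coord_measurable:
  "i < p \<Longrightarrow> (\<lambda>z. \<delta> z i) \<in> borel_measurable (vec_space n \<Otimes>\<^sub>M design_space n p)"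
  using \<delta> unfolding estimators_def
  by (rule measurable_compose) (simp add: measurable_component_singleton)

lemma design_entry_measurable:
  assumes "i < n" "j < p"
  shows "(\<lambda>X. X i j) \<in> borel_measurable (design_space n p)"
proof -
  have "(\<lambda>X. X i) \<in> measurable (design_space n p) (vec_space p)"
    using assms by (intro measurable_component_singleton) simp
  moreover have "(\<lambda>x. x j) \<in> borel_measurable (vec_space p)"
    using assms by (intro measurable_component_singleton) simp
  ultimately show ?thesis by (rule measurable_compose)
qed

text \<open>Every row has marginal law \<open>P\<close>, so the claim follows by linearity. It
  controls the mean squared length of a shift, which is \<open>\<tau>\<^sup>2\<close> times this
  sum.\<close>

lemma nn_integral_rows_coord:
  assumes j: "j < p"
  shows "(\<integral>\<^sup>+X. ennreal (\<Sum>i<n. (X i j)\<^sup>2) \<partial>(\<Pi>\<^sub>M i\<in>{..<n}. P)) \<le> ennreal (n * C)"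
proof -
  have mj: "(\<lambda>x. ennreal ((x j)\<^sup>2)) \<in> borel_measurable P"
    using j by (simp add: measurable_cong_sets[OF sets_P refl])
  have mX: "(\<lambda>X. X i) \<in> measurable (\<Pi>\<^sub>M i\<in>{..<n}. P) P" if "i < n" for i
    using that by (intro measurable_component_singleton) simp
  have "(\<integral>\<^sup>+X. ennreal (\<Sum>i<n. (X i j)\<^sup>2) \<partial>(\<Pi>\<^sub>M i\<in>{..<n}. P))
    = (\<integral>\<^sup>+X. (\<Sum>i<n. ennreal ((X i j)\<^sup>2)) \<partial>(\<Pi>\<^sub>M i\<in>{..<n}. P))"
    by simp
  also have "\<dots> = (\<Sum>i<n. \<integral>\<^sup>+X. ennreal ((X i j)\<^sup>2) \<partial>(\<Pi>\<^sub>M i\<in>{..<n}. P))"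
    by (intro nn_integral_sum measurable_compose[OF mX mj]) simp
  also have "\<dots> \<le> (\<Sum>i<n. ennreal C)"
  proof (rule sum_mono)
    fix i assume i: "i \<in> {..<n}"
    have "(\<integral>\<^sup>+X. ennreal ((X i j)\<^sup>2) \<partial>(\<Pi>\<^sub>M i\<in>{..<n}. P))
      = (\<integral>\<^sup>+x. ennreal ((x j)\<^sup>2) \<partial>distr (\<Pi>\<^sub>M i\<in>{..<n}. P) P (\<lambda>X. X i))"
      using mX mj i by (intro nn_integral_distr[symmetric]) auto
    also have "distr (\<Pi>\<^sub>M i\<in>{..<n}. P) P (\<lambda>X. X i) = P"
      using i prob_P by (intro distr_PiM_component) auto
    finally show "(\<integral>\<^sup>+X. ennreal ((X i j)\<^sup>2) \<partial>(\<Pi>\<^sub>M i\<in>{..<n}. P)) \<le> ennreal C"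
      using second_moment[OF j] by simp
  qed
  also have "\<dots> = ennreal (n * C)"
    using C by (simp add: ennreal_mult ennreal_of_nat_eq_real_of_nat)
  finally show ?thesis .
qed

lemma block_measurable:
  assumes S: "S \<subseteq> {..<p}"
  shows "(\<lambda>(X, e). ennreal (\<Sum>i\<in>S. (\<delta> (response n p X \<beta> e, X) i - \<beta> i)\<^sup>2))
    \<in> borel_measurable (design_space n p \<Otimes>\<^sub>M vec_space n)"
proof -
  have "(\<lambda>z. (response n p (fst z) \<beta> (snd z), fst z))
    \<in> measurable (design_space n p \<Otimes>\<^sub>M vec_space n) (vec_space n \<Otimes>\<^sub>M design_space n p)"
  proof -
    have X: "(\<lambda>z. fst z i k) \<in> borel_measurable (design_space n p \<Otimes>\<^sub>M vec_space n)"
      if "i < n" "k < p" for i k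
      using measurable_compose[OF measurable_fst design_entry_measurable[OF that]] .
    have e: "(\<lambda>z. snd z i) \<in> borel_measurable (design_space n p \<Otimes>\<^sub>M vec_space n)" if "i < n" for i
      using that by (intro measurable_compose[OF measurable_snd measurable_component_singleton]) simp
    have "(\<lambda>z. response n p (fst z) \<beta> (snd z)) \<in> measurable (design_space n p \<Otimes>\<^sub>M vec_space n) (vec_space n)"
      unfolding response_def using X e
      by (intro measurable_restrict borel_measurable_add borel_measurable_sum borel_measurable_times
          borel_measurable_const) auto
    then show ?thesis by (intro measurable_Pair measurable_fst)
  qed
  from measurable_compose[OF this estimator_coord_measurable]
  have "(\<lambda>z. \<delta> (response n p (fst z) \<beta> (snd z), fst z) i)
    \<in> borel_measurable (design_space n p \<Otimes>\<^sub>M vec_space n)" if "i \<in> S" for i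
    using that S by auto
  then show ?thesis unfolding case_prod_beta
    by (intro measurable_compose[OF _ measurable_ennreal] borel_measurable_sum borel_measurable_power
        borel_measurable_diff borel_measurable_const)
qed

text \<open>Tonelli, with the noise integrated first: the testing bound can then be applied for a
  fixed design and averaged over the design afterwards.\<close>

lemma coord_risk_eq:
  assumes S: "S \<subseteq> {..<p}"
  shows "coord_risk n p P \<sigma> \<delta> S \<beta> = (\<integral>\<^sup>+X. \<integral>\<^sup>+e.
    ennreal (\<Sum>i\<in>S. (\<delta> (response n p X \<beta> e, X) i - \<beta> i)\<^sup>2) \<partial>gaussian_noise n \<sigma> \<partial>(\<Pi>\<^sub>M i\<in>{..<n}. P))"
    and "(\<lambda>X. \<integral>\<^sup>+e. ennreal (\<Sum>i\<in>S. (\<delta> (response n p X \<beta> e, X) i - \<beta> i)\<^sup>2) \<partial>gaussian_noise n \<sigma>)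
      \<in> borel_measurable (\<Pi>\<^sub>M i\<in>{..<n}. P)"
proof -
  interpret E: prob_space "gaussian_noise n \<sigma>" by (rule prob_space_gaussian_noise[OF \<sigma>])
  let ?f = "\<lambda>(X, e). ennreal (\<Sum>i\<in>S. (\<delta> (response n p X \<beta> e, X) i - \<beta> i)\<^sup>2)"
  have sets: "sets ((\<Pi>\<^sub>M i\<in>{..<n}. P) \<Otimes>\<^sub>M gaussian_noise n \<sigma>) = sets (design_space n p \<Otimes>\<^sub>M vec_space n)"
    by (intro sets_pair_measure_cong sets_rows sets_gaussian_noise)
  have m: "?f \<in> borel_measurable ((\<Pi>\<^sub>M i\<in>{..<n}. P) \<Otimes>\<^sub>M gaussian_noise n \<sigma>)"
    using block_measurable[OF S] by (simp only: measurable_cong_sets[OF sets refl])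
  show "coord_risk n p P \<sigma> \<delta> S \<beta> = (\<integral>\<^sup>+X. \<integral>\<^sup>+e.
    ennreal (\<Sum>i\<in>S. (\<delta> (response n p X \<beta> e, X) i - \<beta> i)\<^sup>2) \<partial>gaussian_noise n \<sigma> \<partial>(\<Pi>\<^sub>M i\<in>{..<n}. P))"
    using E.nn_integral_fst[OF m] by (simp add: coord_risk_def model_law_def)
  show "(\<lambda>X. \<integral>\<^sup>+e. ennreal (\<Sum>i\<in>S. (\<delta> (response n p X \<beta> e, X) i - \<beta> i)\<^sup>2) \<partial>gaussian_noise n \<sigma>)
      \<in> borel_measurable (\<Pi>\<^sub>M i\<in>{..<n}. P)"
    using E.borel_measurable_nn_integral_fst[OF m] by simp
qed

text \<open>
  The index \<open>j = m\<close> stands for the hypothesis without an entry in the block. With \<open>M = m + 1\<close> the testing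
  bound is used at \<open>V = ln M / 2\<close> and \<open>T = sqrt (M / 2)\<close>; the choice of \<open>\<tau>\<close> makes the mean of \<open>v\<close> at
  most \<open>V / 2\<close>.
\<close>

lemma block_risk_lower_bound:
  fixes c :: "nat \<Rightarrow> nat" and \<beta> :: "nat \<Rightarrow> nat \<Rightarrow> real" and \<beta>\<^sub>0 :: "nat \<Rightarrow> real"
  assumes m: "1 \<le> m" and c: "c ` {..<m} \<subseteq> {..<p}"
    and \<tau>: "\<tau>\<^sup>2 = \<sigma>\<^sup>2 * ln (real m + 1) / (4 * C * n)"
    and \<beta>: "\<And>i j. i < p \<Longrightarrow> \<beta> j i = \<beta>\<^sub>0 i + (if j < m \<and> i = c j then \<tau> else 0)"
    and inj: "inj_on c {..<m}"
  shows "ennreal (7 / 100 * real (m + 1) * (\<tau>\<^sup>2 / 4)) \<le> (\<Sum>j\<le>m. coord_risk n p P \<sigma> \<delta> (c ` {..<m}) (\<beta> j))"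
proof -
  define S where "S = c ` {..<m}"
  have S: "S \<subseteq> {..<p}" "finite S" using c by (auto simp: S_def)
  define M where "M = real m + 1"
  have M: "2 \<le> M" using m by (simp add: M_def)
  define V where "V = ln M / 2"
  have V: "0 < V" using M by (simp add: V_def)
  define T where "T = sqrt (M / 2)"
  have T: "1 \<le> T" using M by (simp add: T_def)
  define q where "q = \<tau>\<^sup>2 / 4"
  have q: "0 \<le> q" by (simp add: q_def)
  \<comment> \<open>For the chosen \<open>V\<close> and \<open>T\<close> the quotient
    \<open>exp V / (4 * T)\<close> equals \<open>sqrt 2 / 4\<close>, and
    \<open>sqrt 2 \<le> 36 / 25\<close> bounds it by \<open>9 / 25\<close>.\<close>
  define \<theta> where "\<theta> = (16 / 25 :: real)"
  have "exp V = sqrt M" using M by (simp add: V_def ln_sqrt[symmetric])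
  also have "\<dots> = sqrt 2 * T" by (simp add: T_def real_sqrt_divide)
  finally have "exp V / (4 * T) = sqrt 2 / 4" using T by simp
  also have "\<dots> \<le> 1 - \<theta>"
    using real_le_lsqrt[of "36 / 25" 2] by (simp add: \<theta>_def power2_eq_square)
  finally have \<theta>: "0 \<le> \<theta>" "exp V / (4 * T) \<le> 1 - \<theta>" by (simp_all add: \<theta>_def)
  let ?R = "\<Pi>\<^sub>M i\<in>{..<n}. P" and ?\<gamma> = "gaussian_noise n \<sigma>"
  interpret R: prob_space ?R by (rule prob_space_rows)
  define h where "h X j i = (if j < m then X i (c j) * \<tau> else 0)" for X :: "nat \<Rightarrow> nat \<Rightarrow> real" and j i
  define \<mu> where "\<mu> X i = (\<Sum>k<p. X i k * \<beta>\<^sub>0 k)" for X :: "nat \<Rightarrow> nat \<Rightarrow> real" and i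
  \<comment> \<open>The mean due to \<open>\<beta>\<^sub>0\<close> is common to all hypotheses and
    is moved into the loss. What distinguishes them is the shift \<open>h X j\<close>, which
    vanishes at \<open>j = m\<close>.\<close>
  define loss where "loss X j y = (\<Sum>i\<in>S. (\<delta> (\<lambda>i\<in>{..<n}. \<mu> X i + y i, X) i - \<beta> j i)\<^sup>2)" for X j y
  have resp: "response n p X (\<beta> j) e = (\<lambda>i\<in>{..<n}. \<mu> X i + (\<lambda>i\<in>{..<n}. e i + h X j i) i)" for X j e
  proof -
    have "(\<Sum>k<p. X i k * \<beta> j k) = \<mu> X i + h X j i" for i
    proof -
      have "(\<Sum>k<p. X i k * \<beta> j k) = (\<Sum>k<p. X i k * \<beta>\<^sub>0 k + (if k = c j then if j < m then X i k * \<tau> else 0 else 0))"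
        by (intro sum.cong) (auto simp: \<beta> algebra_simps)
      also have "\<dots> = \<mu> X i + h X j i"
        using c by (auto simp: sum.distrib \<mu>_def h_def sum.delta)
      finally show ?thesis .
    qed
    then show ?thesis by (auto simp: response_def fun_eq_iff)
  qed
  have pointwise: "ennreal (q * (1 + \<theta> * m)) \<le>
      (\<Sum>j\<le>m. \<integral>\<^sup>+e. ennreal (\<Sum>i\<in>S. (\<delta> (response n p X (\<beta> j) e, X) i - \<beta> j i)\<^sup>2) \<partial>?\<gamma>)
      + ennreal (q * T) + (\<Sum>j<m. ennreal (q * \<theta> * \<tau>\<^sup>2 / (\<sigma>\<^sup>2 * V)) * ennreal (\<Sum>i<n. (X i (c j))\<^sup>2))"
    if X: "X \<in> space ?R" for X
  proof -
    have XD: "X \<in> space (design_space n p)" using X sets_eq_imp_space_eq[OF sets_rows] by simp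
    have "ennreal (q * (1 + \<theta> * card ({..m} - {m}))) \<le>
      (\<Sum>j\<le>m. \<integral>\<^sup>+e. ennreal (loss X j (\<lambda>i\<in>{..<n}. e i + h X j i)) \<partial>?\<gamma>)
      + ennreal (q * T) + (\<Sum>j\<in>{..m} - {m}. ennreal (q * (\<theta> * ((\<Sum>i<n. (h X j i)\<^sup>2) / \<sigma>\<^sup>2) / V)))"
    proof (rule testing_lower_bound[OF \<sigma> T V \<theta> q])
      show "loss X j \<in> borel_measurable (vec_space n)" for j
      proof -
        have "(\<lambda>y. (\<lambda>i\<in>{..<n}. \<mu> X i + y i, X)) \<in> measurable (vec_space n) (vec_space n \<Otimes>\<^sub>M design_space n p)"
          using XD by measurable
        from measurable_compose[OF this estimator_coord_measurable] show ?thesis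
          unfolding loss_def[abs_def] using S
          by (intro borel_measurable_sum borel_measurable_power borel_measurable_diff borel_measurable_const) auto
      qed
      show "0 \<le> loss X j y" for j y by (simp add: loss_def sum_nonneg)
      \<comment> \<open>At the coordinate \<open>c j\<close> the two hypotheses differ by
        \<open>\<tau>\<close>, since by injectivity only the \<open>j\<close>-th has its entry
        there. Losses below \<open>q = \<tau>\<^sup>2 / 4\<close> would place \<open>d\<close>
        closer than half of \<bar>\<tau>\<bar> to both values.\<close>
      have aux: False if j: "j < m" and ne: "i \<noteq> j" and le: "loss X i y < q" "loss X j y < q" for i j y
      proof -
        define d where "d = \<delta> (\<lambda>i\<in>{..<n}. \<mu> X i + y i, X) (c j)"
        have cj: "c j \<in> S" "c j < p" using j c by (auto simp: S_def)
        have coord: "(d - \<beta> r (c j))\<^sup>2 < q" if "loss X r y < q" for r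
          using that member_le_sum[OF cj(1), of "\<lambda>i. (\<delta> (\<lambda>i\<in>{..<n}. \<mu> X i + y i, X) i - \<beta> r i)\<^sup>2"] S
          by (simp add: loss_def d_def)
        have "\<not> (i < m \<and> c j = c i)" using inj j ne by (auto simp: inj_on_def)
        then have "\<beta> i (c j) = \<beta>\<^sub>0 (c j)" "\<beta> j (c j) = \<beta>\<^sub>0 (c j) + \<tau>" using j cj by (auto simp: \<beta>)
        with coord[OF le(1)] coord[OF le(2)]
        have "(d - \<beta>\<^sub>0 (c j))\<^sup>2 < q" "(d - \<beta>\<^sub>0 (c j) - \<tau>)\<^sup>2 < q" by (simp_all add: algebra_simps)
        moreover have "4 * q \<le> 2 * x\<^sup>2 + 2 * (x - \<tau>)\<^sup>2" for x
          using zero_le_power2[of "2 * x - \<tau>"] by (simp add: q_def power2_eq_square algebra_simps)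
        ultimately show False by (smt (verit))
      qed
      show "i = j" if "i \<in> {..m}" "j \<in> {..m}" "loss X i y < q" "loss X j y < q" for i j y
        using aux[of j i y] aux[of i j y] that by (cases "j < m"; cases "i < m"; force)
    qed (auto simp: h_def)
    moreover have "{..m} - {m} = {..<m}" by auto
    moreover have "ennreal (q * (\<theta> * ((\<Sum>i<n. (h X j i)\<^sup>2) / \<sigma>\<^sup>2) / V))
      = ennreal (q * \<theta> * \<tau>\<^sup>2 / (\<sigma>\<^sup>2 * V)) * ennreal (\<Sum>i<n. (X i (c j))\<^sup>2)" if "j < m" for j
    proof -
      have "(\<Sum>i<n. (h X j i)\<^sup>2) = \<tau>\<^sup>2 * (\<Sum>i<n. (X i (c j))\<^sup>2)"
        using that by (simp add: h_def power_mult_distrib sum_distrib_left mult.commute)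
      then show ?thesis
        using q \<theta>(1) V by (subst ennreal_mult[symmetric]) (auto simp: sum_nonneg mult_ac)
    qed
    ultimately show ?thesis by (simp add: resp loss_def)
  qed
  have X2: "(\<lambda>X. ennreal (\<Sum>i<n. (X i (c j))\<^sup>2)) \<in> borel_measurable ?R" if "j < m" for j
  proof -
    have "c j < p" using c that by auto
    then have "(\<lambda>X. ennreal (\<Sum>i<n. (X i (c j))\<^sup>2)) \<in> borel_measurable (design_space n p)"
      by (intro measurable_compose[OF _ measurable_ennreal] borel_measurable_sum borel_measurable_power
          design_entry_measurable) auto
    then show ?thesis by (simp only: measurable_cong_sets[OF sets_rows refl])
  qed
  let ?risks = "\<Sum>j\<le>m. coord_risk n p P \<sigma> \<delta> S (\<beta> j)"
  have "ennreal (q * (1 + \<theta> * m)) = (\<integral>\<^sup>+X. ennreal (q * (1 + \<theta> * m)) \<partial>?R)"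
    by (simp add: R.emeasure_space_1)
  also have "\<dots> \<le> (\<integral>\<^sup>+X. (\<Sum>j\<le>m. \<integral>\<^sup>+e. ennreal (\<Sum>i\<in>S. (\<delta> (response n p X (\<beta> j) e, X) i - \<beta> j i)\<^sup>2) \<partial>?\<gamma>)
      + ennreal (q * T) + (\<Sum>j<m. ennreal (q * \<theta> * \<tau>\<^sup>2 / (\<sigma>\<^sup>2 * V)) * ennreal (\<Sum>i<n. (X i (c j))\<^sup>2)) \<partial>?R)"
    by (rule nn_integral_mono) (rule pointwise)
  also have "\<dots> = ?risks + ennreal (q * T)
      + (\<Sum>j<m. ennreal (q * \<theta> * \<tau>\<^sup>2 / (\<sigma>\<^sup>2 * V)) * (\<integral>\<^sup>+X. ennreal (\<Sum>i<n. (X i (c j))\<^sup>2) \<partial>?R))"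
  proof -
    note mm = coord_risk_eq(2)[OF S(1)] X2
    have "(\<integral>\<^sup>+X. (\<Sum>j<m. ennreal (q * \<theta> * \<tau>\<^sup>2 / (\<sigma>\<^sup>2 * V)) * ennreal (\<Sum>i<n. (X i (c j))\<^sup>2)) \<partial>?R)
      = (\<Sum>j<m. ennreal (q * \<theta> * \<tau>\<^sup>2 / (\<sigma>\<^sup>2 * V)) * (\<integral>\<^sup>+X. ennreal (\<Sum>i<n. (X i (c j))\<^sup>2) \<partial>?R))"
      using X2 by (subst nn_integral_sum) (auto intro!: sum.cong nn_integral_cmult borel_measurable_times_ennreal simp del: sum_ennreal)
    moreover have "(\<integral>\<^sup>+X. (\<Sum>j\<le>m. \<integral>\<^sup>+e. ennreal (\<Sum>i\<in>S. (\<delta> (response n p X (\<beta> j) e, X) i - \<beta> j i)\<^sup>2) \<partial>?\<gamma>) \<partial>?R) = ?risks"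
      using mm(1) by (simp add: coord_risk_eq(1)[OF S(1)] nn_integral_sum)
    ultimately show ?thesis
      using mm by (subst nn_integral_add)
        (auto simp: nn_integral_add R.emeasure_space_1 simp del: sum_ennreal
          intro!: borel_measurable_sum borel_measurable_add borel_measurable_times_ennreal)
  qed
  also have "\<dots> \<le> ?risks + ennreal (q * T) + (\<Sum>j<m. ennreal (q * \<theta> / 2))"
  proof (intro add_left_mono sum_mono)
    fix j assume "j \<in> {..<m}"
    then have "c j < p" using c by auto
    then have "ennreal (q * \<theta> * \<tau>\<^sup>2 / (\<sigma>\<^sup>2 * V)) * (\<integral>\<^sup>+X. ennreal (\<Sum>i<n. (X i (c j))\<^sup>2) \<partial>?R)
      \<le> ennreal (q * \<theta> * \<tau>\<^sup>2 / (\<sigma>\<^sup>2 * V)) * ennreal (n * C)"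
      by (intro mult_left_mono nn_integral_rows_coord) auto
    also have "\<dots> = ennreal (q * \<theta> * \<tau>\<^sup>2 / (\<sigma>\<^sup>2 * V) * (n * C))"
      using q \<theta>(1) V C by (intro ennreal_mult[symmetric]) auto
    \<comment> \<open>The choice of \<open>\<tau>\<close> enters here: on average the error term
      costs each alternative at most half of its weight \<open>\<theta>\<close>.\<close>
    also have "q * \<theta> * \<tau>\<^sup>2 / (\<sigma>\<^sup>2 * V) * (n * C) = q * \<theta> / 2"
    proof -
      have "\<tau>\<^sup>2 = \<sigma>\<^sup>2 * V / (2 * C * n)" by (simp add: \<tau> V_def M_def)
      then show ?thesis using \<sigma> V C n by (simp add: field_simps)
    qed
    finally show "ennreal (q * \<theta> * \<tau>\<^sup>2 / (\<sigma>\<^sup>2 * V)) * (\<integral>\<^sup>+X. ennreal (\<Sum>i<n. (X i (c j))\<^sup>2) \<partial>?R)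
      \<le> ennreal (q * \<theta> / 2)" .
  qed
  also have "\<dots> = ?risks + ennreal (q * T + m * (q * \<theta> / 2))"
    using q \<theta>(1) T by (simp add: ennreal_of_nat_eq_real_of_nat ennreal_mult[symmetric] add.assoc)
  finally have "ennreal (q * (1 + \<theta> * m) - (q * T + m * (q * \<theta> / 2))) \<le> ?risks"
    by (rule ennreal_diff_le) (use q \<theta>(1) T in auto)
  \<comment> \<open>The arithmetic-geometric mean inequality for \<open>M / 2\<close> and
    \<open>1\<close> gives \<open>4 * T \<le> m + 3\<close>. As
    \<open>\<theta> / 2 - 1 / 4 = 7 / 100\<close>, the coefficient of \<open>q\<close> is at least
    \<open>7 / 100 * m + 1 / 4\<close>.\<close>
  moreover have "7 / 100 * real (m + 1) * q \<le> q * (1 + \<theta> * m) - (q * T + m * (q * \<theta> / 2))"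
  proof -
    have "sqrt (M / 2 * 1) \<le> (M / 2 + 1) / 2" by (rule arith_geo_mean_sqrt) (use M in auto)
    then have "T * 2 \<le> M / 2 + 1" by (simp add: T_def)
    then have "4 * T \<le> real m + 3" by (simp add: M_def field_simps)
    then have "7 / 100 * M \<le> 1 + \<theta> * m / 2 - T" by (simp add: \<theta>_def M_def field_simps)
    then have "7 / 100 * M * q \<le> (1 + \<theta> * m / 2 - T) * q" using q by (rule mult_right_mono)
    then show ?thesis by (simp add: M_def algebra_simps)
  qed
  ultimately have "ennreal (7 / 100 * real (m + 1) * q) \<le> ?risks"
    by (meson ennreal_leI order_trans)
  then show ?thesis by (simp only: S_def q_def)
qed

section \<open>From a single block to the supremum over a class\<close>

lemma risk_ge_sum_coord_risk:
  fixes k :: nat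
  assumes S: "\<And>l. l < k \<Longrightarrow> S l \<subseteq> {..<p}" and disj: "disjoint_family_on S {..<k}"
  shows "(\<Sum>l<k. coord_risk n p P \<sigma> \<delta> (S l) \<beta>) \<le> risk n p P \<sigma> \<delta> \<beta>"
proof -
  have "coord_risk n p P \<sigma> \<delta> {..<p} \<beta> = risk n p P \<sigma> \<delta> \<beta>"
    by (simp add: coord_risk_def risk_def L2_set_def sum_nonneg)
  moreover have "(\<Sum>l<k. coord_risk n p P \<sigma> \<delta> (S l) \<beta>) \<le> coord_risk n p P \<sigma> \<delta> {..<p} \<beta>"
  proof -
    have sets: "sets (model_law n P \<sigma>) = sets (design_space n p \<Otimes>\<^sub>M vec_space n)"
      unfolding model_law_def by (intro sets_pair_measure_cong sets_rows sets_gaussian_noise)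
    have m: "(\<lambda>(X, e). ennreal (\<Sum>i\<in>S l. (\<delta> (response n p X \<beta> e, X) i - \<beta> i)\<^sup>2))
        \<in> borel_measurable (model_law n P \<sigma>)" if "l \<in> {..<k}" for l
      using block_measurable[OF S, of l] that by (simp add: measurable_cong_sets[OF sets refl])
    have "(\<Sum>l<k. coord_risk n p P \<sigma> \<delta> (S l) \<beta>)
      = (\<integral>\<^sup>+z. (\<Sum>l<k. case z of (X, e) \<Rightarrow> ennreal (\<Sum>i\<in>S l. (\<delta> (response n p X \<beta> e, X) i - \<beta> i)\<^sup>2)) \<partial>model_law n P \<sigma>)"
      unfolding coord_risk_def using m by (rule nn_integral_sum[symmetric])
    also have "\<dots> \<le> coord_risk n p P \<sigma> \<delta> {..<p} \<beta>"
      unfolding coord_risk_def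
    proof (rule nn_integral_mono, clarify)
      fix X e
      let ?g = "\<lambda>i. (\<delta> (response n p X \<beta> e, X) i - \<beta> i)\<^sup>2"
      have fin: "finite (S l)" if "l < k" for l using S[OF that] by (rule finite_subset) simp
      \<comment> \<open>Disjoint blocks contribute separate terms to the squared error, and the
        remaining coordinates can only add to it.\<close>
      have "(\<Sum>l<k. sum ?g (S l)) = sum ?g (\<Union>l<k. S l)"
        using disj fin by (intro sum.UNION_disjoint[symmetric]) (auto simp: disjoint_family_on_def)
      also have "\<dots> \<le> sum ?g {..<p}" using S by (intro sum_mono2) auto
      finally show "(\<Sum>l<k. ennreal (sum ?g (S l))) \<le> ennreal (sum ?g {..<p})"
        by (simp add: sum_nonneg ennreal_leI)
    qed
    finally show ?thesis .
  qed
  ultimately show ?thesis by simp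
qed

text \<open>The supremum dominates the average over all \<open>J\<close>. In each block, whatever
  the choices in the others, the average contribution is at least
  \<open>7 / 100 * (\<tau>\<^sup>2 / 4)\<close>, and there are \<open>k\<close> blocks.\<close>

lemma block_minimax_lower_bound:
  fixes c :: "nat \<Rightarrow> nat"
  assumes m: "1 \<le> m" and inj: "inj_on c {..<k * m}" and c: "c ` {..<k * m} \<subseteq> {..<p}"
    and \<tau>: "\<tau>\<^sup>2 = \<sigma>\<^sup>2 * ln (real m + 1) / (4 * C * n)"
    and F: "\<And>J. block_vector p k m \<tau> c J \<in> F"
  shows "ennreal (k * (7 / 100 * (\<tau>\<^sup>2 / 4))) \<le> (SUP \<beta>\<in>F. risk n p P \<sigma> \<delta> \<beta>)"
proof -
  define A where "A = {..<k} \<rightarrow>\<^sub>E {..m}"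
  have A: "finite A" "A \<noteq> {}" unfolding A_def by (auto intro!: finite_PiE simp: PiE_eq_empty_iff)
  define a where "a = 7 / 100 * (\<tau>\<^sup>2 / 4)"
  have a: "0 \<le> a" by (simp add: a_def)
  define cl where "cl l j = c (l * m + j)" for l j
  have idx: "l * m + j < k * m" if "l < k" "j < m" for l j
  proof -
    have "l * m + j < Suc l * m" using that by simp
    also have "\<dots> \<le> k * m" using that by (intro mult_right_mono) auto
    finally show ?thesis .
  qed
  \<comment> \<open>Division by \<open>m\<close> with remainder recovers the block and the place
    within it.\<close>
  have idx_inj: "l = l' \<and> j = j'" if "l < k" "j < m" "l' < k" "j' < m" "cl l j = cl l' j'" for l j l' j'
  proof -
    have "l * m + j = l' * m + j'"
      using inj_onD[OF inj that(5)[unfolded cl_def]] idx[OF that(1,2)] idx[OF that(3,4)] by simp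
    then have "(l * m + j) div m = (l' * m + j') div m" "(l * m + j) mod m = (l' * m + j') mod m"
      by simp_all
    then show ?thesis using that by simp
  qed
  define S where "S l = cl l ` {..<m}" for l
  have S: "S l \<subseteq> {..<p}" if "l < k" for l using c idx that by (auto simp: S_def cl_def)
  have disj: "disjoint_family_on S {..<k}"
    unfolding disjoint_family_on_def S_def using idx_inj by blast
  let ?\<beta> = "block_vector p k m \<tau> c"
  let ?R = "\<lambda>l J. coord_risk n p P \<sigma> \<delta> (S l) (?\<beta> J)"
  have block: "of_nat (card A) * ennreal a \<le> (\<Sum>J\<in>A. ?R l J)" if l: "l < k" for l
    unfolding A_def
  proof (rule sum_PiE_ge[OF l])
    fix J :: "nat \<Rightarrow> nat"
    have "ennreal (7 / 100 * real (m + 1) * (\<tau>\<^sup>2 / 4)) \<le> (\<Sum>j\<le>m. ?R l (J(l := j)))"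
      unfolding S_def
    proof (rule block_risk_lower_bound[where \<beta> = "\<lambda>j. ?\<beta> (J(l := j))" and c = "cl l", OF m _ \<tau>])
      show "cl l ` {..<m} \<subseteq> {..<p}" using S[OF l] by (simp add: S_def)
      show "inj_on (cl l) {..<m}" using idx_inj[of l _ l] l by (auto simp: inj_on_def)
      \<comment> \<open>The base vector collects the entries of the other blocks and does not depend
        on \<open>j\<close>.\<close>
      show "?\<beta> (J(l := j)) i = (\<Sum>l'\<in>{..<k} - {l}. if J l' < m \<and> i = c (l' * m + J l') then \<tau> else 0)
          + (if j < m \<and> i = cl l j then \<tau> else 0)" if "i < p" for i j
        using that l by (simp add: block_vector_def sum.remove[of "{..<k}" l] cl_def add.commute)
    qed
    moreover have "of_nat (m + 1) * ennreal a = ennreal (7 / 100 * real (m + 1) * (\<tau>\<^sup>2 / 4))"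
      using a unfolding ennreal_of_nat_eq_real_of_nat
      by (subst ennreal_mult[symmetric]) (auto simp: a_def ac_simps)
    ultimately show "of_nat (m + 1) * ennreal a \<le> (\<Sum>j\<le>m. ?R l (J(l := j)))" by simp
  qed
  \<comment> \<open>For a fixed block the sum over \<open>J\<close> is bounded below; for a fixed
    \<open>J\<close> the sum over the blocks is at most the risk. The finite nonzero factor
    \<open>card A\<close> is cancelled at the end.\<close>
  have "of_nat (card A) * (of_nat k * ennreal a) = (\<Sum>l<k. of_nat (card A) * ennreal a)"
    by (simp add: ac_simps)
  also have "\<dots> \<le> (\<Sum>l<k. \<Sum>J\<in>A. ?R l J)" by (intro sum_mono block) simp
  also have "\<dots> = (\<Sum>J\<in>A. \<Sum>l<k. ?R l J)" by (rule sum.swap)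
  also have "\<dots> \<le> (\<Sum>J\<in>A. SUP \<beta>\<in>F. risk n p P \<sigma> \<delta> \<beta>)"
    by (intro sum_mono order_trans[OF risk_ge_sum_coord_risk[OF S disj]] SUP_upper F)
  also have "\<dots> = of_nat (card A) * (SUP \<beta>\<in>F. risk n p P \<sigma> \<delta> \<beta>)" by simp
  finally have "of_nat k * ennreal a \<le> (SUP \<beta>\<in>F. risk n p P \<sigma> \<delta> \<beta>)"
    using A by (subst (asm) ennreal_mult_le_mult_iff) auto
  moreover have "of_nat k * ennreal a = ennreal (k * a)"
    using a by (simp add: ennreal_of_nat_eq_real_of_nat ennreal_mult)
  ultimately show ?thesis by (simp add: a_def)
qed

end

subsection \<open>Sparse classes\<close>

text \<open>The \<open>N\<close> admissible places are cut into \<open>k\<close> blocks of equal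
  length, and at most one entry per block gives at most \<open>k\<close> nonzero entries. The
  abstract class \<open>F\<close> and the enumeration \<open>c\<close> allow the same bound to serve
  both terms of the rate.\<close>

lemma sparse_minimax_lower_bound:
  fixes c :: "nat \<Rightarrow> nat"
  assumes P: "subgaussian_row_law p \<kappa> c_min C_max P" and C: "0 < C_max"
    and \<sigma>: "0 < \<sigma>" and n: "1 \<le> n" and \<delta>: "\<delta> \<in> estimators n p"
    and k: "1 \<le> k" "k \<le> N" and inj: "inj_on c {..<N}" and c: "c ` {..<N} \<subseteq> {..<p}"
    and F: "\<And>\<beta>. \<beta> \<in> {..<p} \<rightarrow>\<^sub>E UNIV \<Longrightarrow> {j. j < p \<and> \<beta> j \<noteq> 0} \<subseteq> c ` {..<N} \<Longrightarrow> l0_norm p \<beta> \<le> k \<Longrightarrow> \<beta> \<in> F"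
  shows "ennreal (7 / 4800 * \<sigma>\<^sup>2 / (C_max * n) * (k * ln (exp 1 * N / k)))
    \<le> (SUP \<beta>\<in>F. risk n p P \<sigma> \<delta> \<beta>)"
proof -
  \<comment> \<open>Rounding down keeps \<open>k * m \<le> N\<close>, and \<open>k \<le> N\<close>
    makes the blocks nonempty. Rounding is harmless because \<open>N / k < m + 1\<close>, and
    \<open>m + 1\<close> is what stands in the logarithm of \<open>\<tau>\<^sup>2\<close>.\<close>
  define m where "m = N div k"
  have m: "1 \<le> m" using k by (simp add: m_def div_greater_zero_iff Suc_le_eq)
  have km: "k * m \<le> N" by (simp add: m_def)
  then have sub: "{..<k * m} \<subseteq> {..<N}" by auto
  define \<tau> where "\<tau> = sqrt (\<sigma>\<^sup>2 * ln (real m + 1) / (4 * C_max * n))"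
  have \<tau>: "\<tau>\<^sup>2 = \<sigma>\<^sup>2 * ln (real m + 1) / (4 * C_max * n)"
    using C by (simp add: \<tau>_def)
  have "ennreal (k * (7 / 100 * (\<tau>\<^sup>2 / 4))) \<le> (SUP \<beta>\<in>F. risk n p P \<sigma> \<delta> \<beta>)"
  proof (rule block_minimax_lower_bound[where c = c and m = m, OF \<sigma> n C _ _ _ \<delta> m])
    show "prob_space P" "sets P = sets (vec_space p)" using P by (auto simp: subgaussian_row_law_def)
    show "(\<integral>\<^sup>+x. ennreal ((x j)\<^sup>2) \<partial>P) \<le> ennreal C_max" if "j < p" for j
      by (rule subgaussian_second_moment_le[OF P that])
    show "inj_on c {..<k * m}" by (rule inj_on_subset[OF inj sub])
    show "c ` {..<k * m} \<subseteq> {..<p}" by (rule order_trans[OF image_mono[OF sub] c])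
    show "\<tau>\<^sup>2 = \<sigma>\<^sup>2 * ln (real m + 1) / (4 * C_max * n)" by (rule \<tau>)
    fix J :: "nat \<Rightarrow> nat"
    let ?\<beta> = "block_vector p k m \<tau> c J" and ?L = "{l. l < k \<and> J l < m}"
    have supp: "{j. j < p \<and> ?\<beta> j \<noteq> 0} \<subseteq> (\<lambda>l. c (l * m + J l)) ` ?L"
    proof clarify
      fix i assume "i < p" "?\<beta> i \<noteq> 0"
      then have "(\<Sum>l<k. if J l < m \<and> i = c (l * m + J l) then \<tau> else 0) \<noteq> 0"
        by (simp add: block_vector_def)
      then obtain l where "l \<in> {..<k}" "(if J l < m \<and> i = c (l * m + J l) then \<tau> else 0) \<noteq> 0"
        by (rule sum.not_neutral_contains_not_neutral)
      then have "l < k" "J l < m" "i = c (l * m + J l)" by (auto split: if_splits)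
      then show "i \<in> (\<lambda>l. c (l * m + J l)) ` ?L" by blast
    qed
    show "?\<beta> \<in> F"
    proof (rule F)
      show "?\<beta> \<in> {..<p} \<rightarrow>\<^sub>E UNIV" by (simp add: block_vector_def)
      have "l * m + J l < N" if "l < k" "J l < m" for l
      proof -
        have "l * m + J l < Suc l * m" using that by simp
        also have "\<dots> \<le> k * m" using that by (intro mult_right_mono) auto
        finally show ?thesis using km by simp
      qed
      then show "{j. j < p \<and> ?\<beta> j \<noteq> 0} \<subseteq> c ` {..<N}" by (intro order_trans[OF supp]) blast
      have "card {j. j < p \<and> ?\<beta> j \<noteq> 0} \<le> card ?L"
        by (rule surj_card_le[OF _ supp]) simp
      also have "\<dots> \<le> card {..<k}" by (rule card_mono) auto
      finally show "l0_norm p ?\<beta> \<le> k" by (simp add: l0_norm_def)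
    qed
  qed
  moreover have "7 / 4800 * \<sigma>\<^sup>2 / (C_max * n) * (k * ln (exp 1 * N / k)) \<le> k * (7 / 100 * (\<tau>\<^sup>2 / 4))"
  proof -
    have "N < k * (m + 1)" using k dividend_less_times_div[of k N] by (simp add: m_def)
    then have "real N < real k * (m + 1)" by (metis of_nat_less_iff of_nat_mult)
    then have "real N / k \<le> real m + 1" using k by (simp add: divide_le_eq algebra_simps)
    moreover have pos: "0 < real N / k" using k by simp
    ultimately have "ln (real N / k) \<le> ln (real m + 1)" by (subst ln_le_cancel_iff) auto
    moreover have "ln (exp 1 * N / k) = 1 + ln (real N / k)"
      using ln_mult_pos[OF exp_gt_zero pos, of 1] by simp
    ultimately have "ln (exp 1 * N / k) \<le> 1 + ln (real m + 1)" by simp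
    \<comment> \<open>As \<open>1 \<le> m\<close>, the summand one is at most twice the logarithm.
      This factor three and the two factors four in \<open>\<tau>\<^sup>2 / 4\<close> turn
      \<open>7 / 100\<close> into \<open>7 / 4800\<close>.\<close>
    also have "\<dots> \<le> 3 * ln (real m + 1)"
    proof -
      have "2 / 3 \<le> ln (2::real)" by (rule ln2_ge_two_thirds)
      also have "ln (2::real) \<le> ln (real m + 1)" using m by simp
      finally show ?thesis by simp
    qed
    finally have "7 / 4800 * \<sigma>\<^sup>2 / (C_max * n) * (k * ln (exp 1 * N / k))
      \<le> 7 / 4800 * \<sigma>\<^sup>2 / (C_max * n) * (k * (3 * ln (real m + 1)))"
      using C by (intro mult_left_mono) auto
    also have "\<dots> = k * (7 / 100 * (\<tau>\<^sup>2 / 4))" unfolding \<tau> using C n by (simp add: field_simps)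
    finally show ?thesis .
  qed
  ultimately show ?thesis by (meson ennreal_leI order_trans)
qed

theorem theorem5:
  fixes \<kappa> c_min C_max :: real
  assumes "0 < \<kappa>" and "0 < c_min" and "c_min \<le> C_max"
  shows "\<exists>c>0. \<forall>(n::nat) (p::nat) (d::nat) (b::nat) (s::nat) (s\<^sub>g::nat)
           (G :: nat \<Rightarrow> nat set) (P :: (nat \<Rightarrow> real) measure) (\<sigma>::real).
         1 \<le> n \<and> 3 \<le> d \<and> 3 \<le> b \<and> p = d * b \<and> equal_groups d b G \<and>
         1 \<le> s\<^sub>g \<and> s\<^sub>g \<le> d \<and> s\<^sub>g \<le> s \<and> s \<le> s\<^sub>g * b \<and> 0 < \<sigma> \<and>
         subgaussian_row_law p \<kappa> c_min C_max P \<longrightarrow>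
         (INF \<delta>\<in>estimators n p. SUP \<beta>\<in>sparse_class p d G s s\<^sub>g. risk n p P \<sigma> \<delta> \<beta>)
           \<ge> ennreal (c * (\<sigma>\<^sup>2 * (real s\<^sub>g * ln (exp 1 * real d / real s\<^sub>g)
                                  + real s * ln (exp 1 * real s\<^sub>g * real b / real s)) / real n))"
proof (intro exI[of _ "7 / (9600 * C_max)"] conjI allI impI)
  have C: "0 < C_max" using assms by simp
  then show "0 < 7 / (9600 * C_max)" by simp
  fix n p d b s s\<^sub>g :: nat and G :: "nat \<Rightarrow> nat set" and P :: "(nat \<Rightarrow> real) measure" and \<sigma> :: real
  assume H: "1 \<le> n \<and> 3 \<le> d \<and> 3 \<le> b \<and> p = d * b \<and> equal_groups d b G \<and>
         1 \<le> s\<^sub>g \<and> s\<^sub>g \<le> d \<and> s\<^sub>g \<le> s \<and> s \<le> s\<^sub>g * b \<and> 0 < \<sigma> \<and>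
         subgaussian_row_law p \<kappa> c_min C_max P"
  then have n: "1 \<le> n" and b: "3 \<le> b" and sg: "1 \<le> s\<^sub>g" "s\<^sub>g \<le> d" and s: "s\<^sub>g \<le> s" "s \<le> s\<^sub>g * b"
    and \<sigma>: "0 < \<sigma>" and P: "subgaussian_row_law p \<kappa> c_min C_max P"
    by blast+
  have G: "\<And>g. g < d \<Longrightarrow> G g \<subseteq> {..<p}" "\<And>g. g < d \<Longrightarrow> card (G g) = b"
    using H by (auto simp: equal_groups_def)
  have G_eq: "g = g'" if "g < d" "g' < d" "j \<in> G g" "j \<in> G g'" for g g' j
    using H that by (auto simp: equal_groups_def disjoint_family_on_def)
  define A where "A = s\<^sub>g * ln (exp 1 * d / s\<^sub>g)"
  define B where "B = s * ln (exp 1 * s\<^sub>g * b / s)"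
  define K where "K = 7 / 4800 * \<sigma>\<^sup>2 / (C_max * n)"
  have K: "0 \<le> K" using C by (simp add: K_def)
  show "ennreal (7 / (9600 * C_max) * (\<sigma>\<^sup>2 * (s\<^sub>g * ln (exp 1 * d / s\<^sub>g)
      + s * ln (exp 1 * s\<^sub>g * b / s)) / n))
    \<le> (INF \<delta>\<in>estimators n p. SUP \<beta>\<in>sparse_class p d G s s\<^sub>g. risk n p P \<sigma> \<delta> \<beta>)"
  proof (rule INF_greatest)
    fix \<delta> assume \<delta>: "\<delta> \<in> estimators n p"
    let ?sup = "SUP \<beta>\<in>sparse_class p d G s s\<^sub>g. risk n p P \<sigma> \<delta> \<beta>"
    \<comment> \<open>The between-group term: with one representative per group as admissible
      places, the general bound applies with \<open>N = d\<close> and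
      \<open>k = s\<^sub>g\<close>.\<close>
    have 1: "ennreal (K * A) \<le> ?sup"
    proof -
      define r where "r g = (SOME j. j \<in> G g)" for g
      have r: "r g \<in> G g" if "g < d" for g
      proof -
        have "G g \<noteq> {}" using G(2)[OF that] b by auto
        then show ?thesis unfolding r_def by (rule some_in_eq[THEN iffD2])
      qed
      have inj: "inj_on r {..<d}" using r G_eq by (metis inj_onI lessThan_iff)
      show ?thesis unfolding K_def A_def
      proof (rule sparse_minimax_lower_bound[OF P C \<sigma> n \<delta> sg inj])
        show "r ` {..<d} \<subseteq> {..<p}" using r G(1) by blast
        fix \<beta> assume \<beta>: "\<beta> \<in> {..<p} \<rightarrow>\<^sub>E (UNIV :: real set)"
          and supp: "{j. j < p \<and> \<beta> j \<noteq> 0} \<subseteq> r ` {..<d}" and l0: "l0_norm p \<beta> \<le> s\<^sub>g"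
        let ?groups = "{g. g < d \<and> (\<exists>j\<in>G g. \<beta> j \<noteq> 0)}"
        \<comment> \<open>The support consists of representatives, so a nonzero entry of a group
          sits at its own representative. Active groups therefore inject into nonzero
          entries.\<close>
        have "r ` ?groups \<subseteq> {j. j < p \<and> \<beta> j \<noteq> 0}"
        proof clarify
          fix g j assume g: "g < d" "j \<in> G g" "\<beta> j \<noteq> 0"
          then have "j \<in> r ` {..<d}" using supp G(1) by blast
          then obtain g' where "g' < d" "j = r g'" by auto
          then have "j = r g" using G_eq r g by blast
          then show "r g < p \<and> \<beta> (r g) \<noteq> 0" using g G(1) by blast
        qed
        then have "card ?groups \<le> l0_norm p \<beta>"
          unfolding l0_norm_def by (intro card_inj_on_le[of r] inj_on_subset[OF inj]) auto
        then show "\<beta> \<in> sparse_class p d G s s\<^sub>g"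
          using \<beta> l0 s by (simp add: sparse_class_def group_l0_norm_def)
      qed
    qed
    \<comment> \<open>The within-group term: all places of the first \<open>s\<^sub>g\<close> groups
      are admissible, so \<open>N = s\<^sub>g * b\<close> and \<open>k = s\<close>. Group sparsity
      then follows from the location of the support.\<close>
    have 2: "ennreal (K * B) \<le> ?sup"
    proof -
      define U where "U = (\<Union>g<s\<^sub>g. G g)"
      have fin: "finite (G g)" if "g < d" for g using G(1)[OF that] by (rule finite_subset) simp
      have "card U = (\<Sum>g<s\<^sub>g. card (G g))"
        unfolding U_def using sg fin G_eq by (intro card_UN_disjoint) (auto simp: disjoint_iff)
      then have cU: "card U = s\<^sub>g * b" using G(2) sg by simp
      have "finite U" unfolding U_def using fin sg by auto
      then obtain c where c: "bij_betw c {..<s\<^sub>g * b} U"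
        using ex_bij_betw_nat_finite[of U] cU by (auto simp: lessThan_atLeast0)
      have "ennreal (7 / 4800 * \<sigma>\<^sup>2 / (C_max * n) * (s * ln (exp 1 * real (s\<^sub>g * b) / s))) \<le> ?sup"
      proof (rule sparse_minimax_lower_bound[OF P C \<sigma> n \<delta> _ _ bij_betw_imp_inj_on[OF c]])
        show "1 \<le> s" "s \<le> s\<^sub>g * b" using s sg by auto
        show "c ` {..<s\<^sub>g * b} \<subseteq> {..<p}"
          unfolding bij_betw_imp_surj_on[OF c] U_def by (intro UN_least G(1)) (use sg in auto)
        fix \<beta> assume \<beta>: "\<beta> \<in> {..<p} \<rightarrow>\<^sub>E (UNIV :: real set)"
          and supp: "{j. j < p \<and> \<beta> j \<noteq> 0} \<subseteq> c ` {..<s\<^sub>g * b}" and l0: "l0_norm p \<beta> \<le> s"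
        have "{g. g < d \<and> (\<exists>j\<in>G g. \<beta> j \<noteq> 0)} \<subseteq> {..<s\<^sub>g}"
        proof clarify
          fix g j assume g: "g < d" "j \<in> G g" "\<beta> j \<noteq> 0"
          then have "j \<in> U" using supp G(1) bij_betw_imp_surj_on[OF c] by blast
          then obtain g' where "g' < s\<^sub>g" "j \<in> G g'" by (auto simp: U_def)
          then show "g < s\<^sub>g" using G_eq[of g g' j] g sg by auto
        qed
        from card_mono[OF _ this] have "group_l0_norm d G \<beta> \<le> s\<^sub>g" by (simp add: group_l0_norm_def)
        then show "\<beta> \<in> sparse_class p d G s s\<^sub>g" using \<beta> l0 by (simp add: sparse_class_def)
      qed
      then show ?thesis by (simp add: K_def B_def mult.assoc)
    qed
    \<comment> \<open>The larger of the two bounds is at least their average, which halves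
      \<open>7 / 4800\<close> to \<open>7 / 9600\<close>.\<close>
    have eq: "7 / (9600 * C_max) * (\<sigma>\<^sup>2 * (A + B) / n) = (K * A + K * B) / 2"
      using C n by (simp add: K_def field_simps)
    have avg: "(x + y) / 2 \<le> x \<or> (x + y) / 2 \<le> y" for x y :: real by (cases "x \<le> y") auto
    from avg[of "K * A" "K * B"] have "ennreal ((K * A + K * B) / 2) \<le> ?sup"
      using order_trans[OF ennreal_leI 1] order_trans[OF ennreal_leI 2] by blast
    then show "ennreal (7 / (9600 * C_max) * (\<sigma>\<^sup>2 * (s\<^sub>g * ln (exp 1 * d / s\<^sub>g)
      + s * ln (exp 1 * s\<^sub>g * b / s)) / n)) \<le> ?sup"
      unfolding A_def[symmetric] B_def[symmetric] eq .
  qed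
qed

end
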